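(* There exists a sequence of instances of sequential selection with expirations (SSE) such that, as the number of options $n\to\infty$, the expected value obtained by Algorithm 1 is at most $\left(1-\frac1{\sqrt e}\right)$ times the optimal value of the linear program $(\mathrm{LP})$. (Algorithm 1 and $(\mathrm{LP})$ are defined in the context.)
   Context: SSE problem. An instance consists of $n$ options. Option $j\in[n]=\{1,\dots,n\}$ has a deterministic value $v_j>0$, a random evaluation time $S_j$ and a random expiration time $E_j$, both taking positive integer values; all these $2n$ random variables are mutually independent, with known distributions and initially unknown realizations. Write $\overline F_{S_j}(t)=\Pr(S_j>t)$ and $p_j(t)=\Pr(E_j>t)$. It is assumed that there is $T\in\mathbb N$ with $\overline F_{S_j}(T)=0$ for all $j$, and that $p_j(t)>0$ for all $j\in[n]$ and all $t\ge1$. Time is discrete, $t=1,2,\dots$. Option $j$ is unexpired at time $t$ iff $E_j>t$; all options are available at time $1$. A decision-maker (DM) evaluates one option at a time and is free at time 1. If the DM is free at time $t$, it may select one option $j$ that is unexpired at time $t$ and has not been selected before; it is then busy for $S_j$ time units (free again at time $t+S_j$) and obtains value $v_j$. A selected option cannot be preempted and cannot expire. Meanwhile other options may expire. If the DM selects nothing at $t$, it is still free at $t+1$. The value of a policy is the expected sum of the values of the selected options. Linear program $(\mathrm{LP})$. Maximize $\sum_{t=1}^{nT}\sum_{j=1}^n v_j x_{j,t}$ subject to $\sum_{t=1}^{nT} x_{j,t}/p_j(t)\le 1$ for all $j\in[n]$; $\sum_{\tau\le t}\sum_{j=1}^n\overline F_{S_j}(t-\tau)\,x_{j,\tau}\le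 1$ for all $t\in[nT]$; $x_{j,t}\ge0$ for all $j\in[n]$, $t\in[nT]$. Algorithm 1. Let $\mathbf x^*$ be the optimal solution of $(\mathrm{LP})$ (with $x^*_{j,t}=0$ for $t>nT$). Initialize $\mathcal C=[n]$. For $t=1,2,\dots$: if the DM is free at time $t$, form a consideration set $\mathcal C^*$ by adding each $j\in\mathcal C$ independently with probability $\frac{x^*_{j,t}}{2\,p_j(t)\,f_{j,t}}$ (probability $0$ if $x^*_{j,t}=0$), and, if $\mathcal C^*\neq\emptyset$, select an option of maximum value $v_j$ in $\mathcal C^*$. All options in $\mathcal C^*$ (they are said to have been "considered" at time $t$) and all options that expire are removed from $\mathcal C$; thus at each time $\mathcal C$ consists of the unexpired options that have not been considered before. Here $f_{j,t}$ is the conditional probability, given that option $j$ is unexpired at time $t$ (i.e. $E_j>t$), that under this algorithm $j$ has not been considered before time $t$ and the DM is free at time $t$. *)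

theory Defs
  imports "HOL-Probability.Probability"
begin

section \<open>Instances of sequential selection with expirations\<close>

text \<open>Options are the natural numbers \<open>1, \<dots>, num_opts I\<close>; what the fields contain for other
  indices is irrelevant.\<close>

record sse =
  num_opts :: nat
  val :: "nat \<Rightarrow> real"
  eval_time :: "nat \<Rightarrow> nat pmf"
  exp_time :: "nat \<Rightarrow> nat pmf"
  max_time :: nat

abbreviation opts :: "sse \<Rightarrow> nat set" where
  "opts I \<equiv> {1..num_opts I}"

definition surv_eval :: "sse \<Rightarrow> nat \<Rightarrow> nat \<Rightarrow> real" where
  "surv_eval I j t = measure_pmf.prob (eval_time I j) {s. s > t}"

definition surv_exp :: "sse \<Rightarrow> nat \<Rightarrow> nat \<Rightarrow> real" where
  "surv_exp I j t = measure_pmf.prob (exp_time I j) {e. e > t}"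

text \<open>The condition \<open>surv_exp I j 1 = 1\<close> says that all options are available at time 1,
  availability at time \<open>t\<close> meaning that the expiration time is \<open>> t\<close>.\<close>

definition sse_instance :: "sse \<Rightarrow> bool" where
  "sse_instance I \<longleftrightarrow> (\<forall>j\<in>opts I.
      val I j > 0 \<and>
      set_pmf (eval_time I j) \<subseteq> {1..} \<and>
      set_pmf (exp_time I j) \<subseteq> {1..} \<and>
      surv_eval I j (max_time I) = 0 \<and>
      surv_exp I j 1 = 1 \<and>
      (\<forall>t\<ge>1. surv_exp I j t > 0))"


section \<open>The linear program\<close>

abbreviation lp_times :: "sse \<Rightarrow> nat set" where
  "lp_times I \<equiv> {1..num_opts I * max_time I}"

text \<open>The first condition only fixes the convention that variables which do not occur in
  the program (in particular those with \<open>t > nT\<close>) are read as 0.\<close>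

definition lp_feasible :: "sse \<Rightarrow> (nat \<Rightarrow> nat \<Rightarrow> real) \<Rightarrow> bool" where
  "lp_feasible I x \<longleftrightarrow>
     (\<forall>j t. j \<notin> opts I \<or> t \<notin> lp_times I \<longrightarrow> x j t = 0) \<and>
     (\<forall>j\<in>opts I. (\<Sum>t\<in>lp_times I. x j t / surv_exp I j t) \<le> 1) \<and>
     (\<forall>t\<in>lp_times I. (\<Sum>\<tau>=1..t. \<Sum>j\<in>opts I. surv_eval I j (t - \<tau>) * x j \<tau>) \<le> 1) \<and>
     (\<forall>j\<in>opts I. \<forall>t\<in>lp_times I. x j t \<ge> 0)"

definition lp_objective :: "sse \<Rightarrow> (nat \<Rightarrow> nat \<Rightarrow> real) \<Rightarrow> real" where
  "lp_objective I x = (\<Sum>t\<in>lp_times I. \<Sum>j\<in>opts I. val I j * x j t)"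

definition lp_optimal :: "sse \<Rightarrow> (nat \<Rightarrow> nat \<Rightarrow> real) \<Rightarrow> bool" where
  "lp_optimal I x \<longleftrightarrow> lp_feasible I x \<and> (\<forall>y. lp_feasible I y \<longrightarrow> lp_objective I y \<le> lp_objective I x)"

definition lp_value :: "sse \<Rightarrow> real" where
  "lp_value I = (SUP x\<in>{x. lp_feasible I x}. lp_objective I x)"


section \<open>The algorithm\<close>

text \<open>
  The evaluation and expiration times are drawn once at the beginning and kept in the state;
  the algorithm looks at an evaluation time only through the time at which the decision-maker
  becomes free again, and at the expiration times only through which options are unexpired.
  The decision-maker is free at time \<open>t\<close> iff \<open>free_at s \<le> t\<close>.
\<close>

record state =
  evals :: "nat \<Rightarrow> nat"
  exps :: "nat \<Rightarrow> nat"
  considered :: "nat set"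
  selected :: "nat set"
  free_at :: nat

definition init_law :: "sse \<Rightarrow> state pmf" where
  "init_law I =
     do {
       S \<leftarrow> Pi_pmf (opts I) 0 (eval_time I);
       E \<leftarrow> Pi_pmf (opts I) 0 (exp_time I);
       return_pmf \<lparr>evals = S, exps = E, considered = {}, selected = {}, free_at = 1\<rparr>
     }"

definition candidates :: "sse \<Rightarrow> nat \<Rightarrow> state \<Rightarrow> nat set" where
  "candidates I t s = {j \<in> opts I. exps s j > t \<and> j \<notin> considered s}"

text \<open>Ties among options of maximum value are broken by a rule that maps the time
  and the consideration set to an option.\<close>

definition max_selector :: "sse \<Rightarrow> (nat \<Rightarrow> nat set \<Rightarrow> nat) \<Rightarrow> bool" where
  "max_selector I sel \<longleftrightarrow> (\<forall>t A. A \<subseteq> opts I \<and> A \<noteq> {} \<longrightarrow>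
      sel t A \<in> A \<and> (\<forall>k\<in>A. val I k \<le> val I (sel t A)))"

text \<open>One time step \<open>t\<close>, where \<open>q j\<close> is the probability of adding candidate \<open>j\<close>
  to the consideration set. (\<open>bernoulli_pmf\<close> truncates its argument to \<open>[0,1]\<close>; for feasible
  \<open>x\<close> the constraints of the linear program give \<open>f\<^sub>j\<^sub>,\<^sub>t \<ge> 1/2\<close>, so the probabilities used by
  the algorithm already lie there.)\<close>

definition step :: "sse \<Rightarrow> (nat \<Rightarrow> nat set \<Rightarrow> nat) \<Rightarrow> nat \<Rightarrow> (nat \<Rightarrow> real) \<Rightarrow> state \<Rightarrow> state pmf" where
  "step I sel t q s =
     (if free_at s \<le> t then
        do {
          b \<leftarrow> Pi_pmf (candidates I t s) False (\<lambda>j. bernoulli_pmf (q j));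
          let A = {j \<in> candidates I t s. b j};
          return_pmf
            (if A = {} then s
             else s\<lparr>considered := considered s \<union> A,
                    selected := insert (sel t A) (selected s),
                    free_at := t + evals s (sel t A)\<rparr>)
        }
      else return_pmf s)"

text \<open>\<open>free_prob t \<mu> j\<close> is the quantity \<open>f\<^sub>j\<^sub>,\<^sub>t\<close> if \<open>\<mu>\<close> is the law of the state just before
  time step \<open>t\<close>.\<close>

definition free_prob :: "nat \<Rightarrow> state pmf \<Rightarrow> nat \<Rightarrow> real" where
  "free_prob t \<mu> j =
     cond_prob (measure_pmf \<mu>) (\<lambda>s. j \<notin> considered s \<and> free_at s \<le> t) (\<lambda>s. exps s j > t)"

definition consider_prob :: "sse \<Rightarrow> (nat \<Rightarrow> nat \<Rightarrow> real) \<Rightarrow> nat \<Rightarrow> state pmf \<Rightarrow> nat \<Rightarrow> real" where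
  "consider_prob I x t \<mu> j =
     (if x j t = 0 then 0 else x j t / (2 * surv_exp I j t * free_prob t \<mu> j))"

text \<open>\<open>alg_law I x sel k\<close> is the law of the state after the time steps \<open>1, \<dots>, k\<close>, i.e. just
  before time step \<open>k + 1\<close>. The \<open>f\<^sub>j\<^sub>,\<^sub>t\<close> are thus defined along with the algorithm, by
  recursion on time.\<close>

primrec alg_law :: "sse \<Rightarrow> (nat \<Rightarrow> nat \<Rightarrow> real) \<Rightarrow> (nat \<Rightarrow> nat set \<Rightarrow> nat) \<Rightarrow> nat \<Rightarrow> state pmf" where
  "alg_law I x sel 0 = init_law I"
| "alg_law I x sel (Suc k) =
     (let \<mu> = alg_law I x sel k
      in bind_pmf \<mu> (step I sel (Suc k) (consider_prob I x (Suc k) \<mu>)))"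

text \<open>The sequence below is nondecreasing and bounded, since \<open>selected\<close> only grows; its limit is
  the expected total value of all options that are ever selected.\<close>

definition alg_value :: "sse \<Rightarrow> (nat \<Rightarrow> nat \<Rightarrow> real) \<Rightarrow> (nat \<Rightarrow> nat set \<Rightarrow> nat) \<Rightarrow> real" where
  "alg_value I x sel =
     lim (\<lambda>k. measure_pmf.expectation (alg_law I x sel k) (\<lambda>s. \<Sum>j\<in>selected s. val I j))"


section \<open>Optimal solutions and selection rules exist\<close>

text \<open>Hence quantifying universally over them is never vacuous.\<close>

lemma max_selector_exists: "\<exists>sel. max_selector I sel"
proof -
  have "\<exists>j\<in>A. \<forall>k\<in>A. val I k \<le> val I j" if "A \<subseteq> opts I" "A \<noteq> {}" for A
  proof -
    have fin: "finite A"
      using that(1) finite_subset by blast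
    have "Max (val I ` A) \<in> val I ` A"
      using fin that(2) by (intro Max_in) auto
    then obtain j where "j \<in> A" "val I j = Max (val I ` A)"
      by force
    thus ?thesis
      using fin by (metis Max_ge finite_imageI image_eqI)
  qed
  then obtain c where "c A \<in> A \<and> (\<forall>k\<in>A. val I k \<le> val I (c A))"
    if "A \<subseteq> opts I" "A \<noteq> {}" for A
    by metis
  hence "max_selector I (\<lambda>_. c)"
    by (simp add: max_selector_def)
  thus ?thesis
    by blast
qed

lemma lp_optimal_exists:
  assumes I: "sse_instance I"
  shows "\<exists>x. lp_optimal I x"
proof -
  define K where "K = (\<lambda>j. PiE UNIV (\<lambda>t. if j \<in> opts I \<and> t \<in> lp_times I then {0..1::real} else {0}))"
  define B where "B = PiE UNIV K"
  have "compactin (product_topology (\<lambda>_. euclidean) UNIV) (K j)" for j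
    unfolding K_def by (subst compactin_PiE) (auto simp: compactin_euclidean_iff)
  hence "compact (K j)" for j
    by (simp add: euclidean_product_topology compactin_euclidean_iff)
  hence "compactin (product_topology (\<lambda>_. euclidean) UNIV) B"
    unfolding B_def by (subst compactin_PiE) (auto simp: compactin_euclidean_iff)
  hence cB: "compact B"
    by (simp add: euclidean_product_topology compactin_euclidean_iff)
  have coord: "continuous_on UNIV (\<lambda>x::nat \<Rightarrow> nat \<Rightarrow> real. x j t)" for j t
    by (rule continuous_on_product_then_coordinatewise) simp
  have S: "surv_exp I j t > 0" "surv_exp I j t \<le> 1" if "j \<in> opts I" "t \<in> lp_times I" for j t
    using I that by (auto simp: sse_instance_def surv_exp_def)
  have le1: "x j t \<le> 1" if x: "lp_feasible I x" and jt: "j \<in> opts I" "t \<in> lp_times I" for x j t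
  proof -
    have "x j t / surv_exp I j t \<le> (\<Sum>t\<in>lp_times I. x j t / surv_exp I j t)"
      using x jt S by (intro member_le_sum) (auto simp: lp_feasible_def intro!: divide_nonneg_pos)
    also have "\<dots> \<le> 1"
      using x jt by (auto simp: lp_feasible_def)
    finally show ?thesis
      using S[OF jt] by (simp add: divide_le_eq)
  qed
  have sub: "{x. lp_feasible I x} \<subseteq> B"
    using le1 by (auto simp: B_def K_def lp_feasible_def)
  have "closed {x. lp_feasible I x}"
    unfolding lp_feasible_def Ball_def divide_inverse
    by (intro closed_Collect_conj closed_Collect_all closed_Collect_imp open_Collect_const
          closed_Collect_eq closed_Collect_le continuous_intros coord)
  hence "compact (B \<inter> {x. lp_feasible I x})"
    using cB by blast
  hence "compact {x. lp_feasible I x}"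
    using sub by (simp add: Int_absorb1)
  moreover have "lp_feasible I (\<lambda>_ _. 0)"
    by (auto simp: lp_feasible_def)
  moreover have "continuous_on {x. lp_feasible I x} (lp_objective I)"
    unfolding lp_objective_def
    by (rule continuous_on_subset[OF _ subset_UNIV]) (intro continuous_intros coord)
  ultimately obtain x where "lp_feasible I x" "\<forall>y\<in>{x. lp_feasible I x}. lp_objective I y \<le> lp_objective I x"
    using continuous_attains_sup[of "{x. lp_feasible I x}" "lp_objective I"] by auto
  thus ?thesis
    by (auto simp: lp_optimal_def)
qed

end

theory Submission
  imports Defs
begin

text \<open>
  Let the \<open>n - 1\<close> main options take one time unit, have value about 1, and survive time 1 only with
  a tiny probability. Almost all of the value of the linear program is then the total mass
  \<open>\<Sum>j. x j 1 \<le> 1\<close> at time 1. If an optimal solution must spread this mass evenly, then at time 1 each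
  main option is considered independently with probability \<open>1 / (2 * (n - 1))\<close>, so none is considered
  with probability close to \<open>exp (- 1 / 2)\<close>, and whatever is selected later is negligible.

  The spreading is forced by second-order effects. Main option \<open>j\<close> survives with probability \<open>rho\<close> up to
  time \<open>j\<close>, so in an optimal solution its mass not used at time 1 goes to time \<open>j\<close>, as
  \<open>x j j = rho * (1 - x j 1)\<close>. A filler option of negligible value occupies all times \<open>2, \<dots>, n\<close> at once
  and leaves just the room \<open>rho * (1 - 1 / (n - 1))\<close> at each of them; hence \<open>x j 1 \<ge> 1 / (n - 1)\<close> for all
  \<open>j\<close>. Complementary slackness with explicit dual prices shows that every optimal solution has
  this form.
\<close>

declare One_nat_def [simp del]

section \<open>Complementary slackness\<close>

definition lp_load :: "sse \<Rightarrow> (nat \<Rightarrow> nat \<Rightarrow> real) \<Rightarrow> nat \<Rightarrow> real" where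
  "lp_load I x t = (\<Sum>\<tau>=1..t. \<Sum>j\<in>opts I. surv_eval I j (t - \<tau>) * x j \<tau>)"

definition lp_use :: "sse \<Rightarrow> (nat \<Rightarrow> nat \<Rightarrow> real) \<Rightarrow> nat \<Rightarrow> real" where
  "lp_use I x j = (\<Sum>t\<in>lp_times I. x j t / surv_exp I j t)"

text \<open>Slack of the dual constraint belonging to the variable \<open>x j t\<close>, with
  \<open>\<alpha>\<close> pricing the options and \<open>\<beta>\<close> the times: a selection pays
  for each time of the horizon at which its evaluation may still run.\<close>

definition reduced_cost :: "sse \<Rightarrow> (nat \<Rightarrow> real) \<Rightarrow> (nat \<Rightarrow> real) \<Rightarrow> nat \<Rightarrow> nat \<Rightarrow> real" where
  "reduced_cost I \<alpha> \<beta> j t = \<alpha> j / surv_exp I j t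
     + (\<Sum>s=t..num_opts I * max_time I. surv_eval I j (s - t) * \<beta> s) - val I j"

text \<open>A pure rearrangement, valid without feasibility: after the sums are exchanged, each
  \<open>x j \<tau>\<close> collects the prices of all times it may occupy.\<close>

lemma lp_objective_eq_dual:
  "lp_objective I x = (\<Sum>j\<in>opts I. \<alpha> j * lp_use I x j) + (\<Sum>t\<in>lp_times I. \<beta> t * lp_load I x t)
     - (\<Sum>j\<in>opts I. \<Sum>t\<in>lp_times I. reduced_cost I \<alpha> \<beta> j t * x j t)"
proof -
  define N where "N = num_opts I * max_time I"
  have "(\<Sum>s\<in>{1..N}. \<beta> s * lp_load I x s)
      = (\<Sum>s\<in>{1..N}. \<Sum>\<tau>\<in>{1..s}. \<Sum>j\<in>opts I. \<beta> s * surv_eval I j (s - \<tau>) * x j \<tau>)"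
    by (simp add: lp_load_def sum_distrib_left mult.assoc)
  also have "\<dots> = (\<Sum>s\<in>{1..N}. \<Sum>\<tau>\<in>{\<tau>\<in>{1..N}. \<tau> \<le> s}. \<Sum>j\<in>opts I. \<beta> s * surv_eval I j (s - \<tau>) * x j \<tau>)"
    by (intro sum.cong) auto
  also have "\<dots> = (\<Sum>\<tau>\<in>{1..N}. \<Sum>s\<in>{s\<in>{1..N}. \<tau> \<le> s}. \<Sum>j\<in>opts I. \<beta> s * surv_eval I j (s - \<tau>) * x j \<tau>)"
    by (rule sum.swap_restrict) auto
  also have "\<dots> = (\<Sum>\<tau>\<in>{1..N}. \<Sum>j\<in>opts I. (\<Sum>s=\<tau>..N. surv_eval I j (s - \<tau>) * \<beta> s) * x j \<tau>)"
  proof (rule sum.cong[OF refl])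
    fix \<tau> assume "\<tau> \<in> {1..N}"
    then have "{s\<in>{1..N}. \<tau> \<le> s} = {\<tau>..N}" by auto
    then show "(\<Sum>s\<in>{s\<in>{1..N}. \<tau> \<le> s}. \<Sum>j\<in>opts I. \<beta> s * surv_eval I j (s - \<tau>) * x j \<tau>)
        = (\<Sum>j\<in>opts I. (\<Sum>s=\<tau>..N. surv_eval I j (s - \<tau>) * \<beta> s) * x j \<tau>)"
      by (subst sum.swap) (simp add: sum_distrib_left sum_distrib_right mult_ac)
  qed
  also have "\<dots> = (\<Sum>j\<in>opts I. \<Sum>\<tau>\<in>{1..N}. (\<Sum>s=\<tau>..N. surv_eval I j (s - \<tau>) * \<beta> s) * x j \<tau>)"
    by (rule sum.swap)
  finally have load: "(\<Sum>s\<in>{1..N}. \<beta> s * lp_load I x s)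
      = (\<Sum>j\<in>opts I. \<Sum>\<tau>\<in>{1..N}. (\<Sum>s=\<tau>..N. surv_eval I j (s - \<tau>) * \<beta> s) * x j \<tau>)" .
  have obj: "lp_objective I x = (\<Sum>j\<in>opts I. \<Sum>t\<in>{1..N}. val I j * x j t)"
    unfolding lp_objective_def N_def by (rule sum.swap)
  have "(\<Sum>j\<in>opts I. \<Sum>t\<in>{1..N}. reduced_cost I \<alpha> \<beta> j t * x j t)
      = (\<Sum>j\<in>opts I. \<alpha> j * lp_use I x j)
        + (\<Sum>j\<in>opts I. \<Sum>t\<in>{1..N}. (\<Sum>s=t..N. surv_eval I j (s - t) * \<beta> s) * x j t)
        - (\<Sum>j\<in>opts I. \<Sum>t\<in>{1..N}. val I j * x j t)"
    unfolding reduced_cost_def lp_use_def N_def[symmetric]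
    by (simp add: ring_distribs left_diff_distrib sum.distrib sum_subtractf sum_distrib_left)
  with load obj show ?thesis
    by (simp add: N_def)
qed

text \<open>For a feasible point the gap to the dual objective is a sum of nonnegative terms. The
  certificate \<open>y\<close> brings it to 0, so every optimal \<open>x\<close> does too, and each
  single term vanishes. This restricts all optima instead of merely exhibiting one.\<close>

lemma complementary_slackness:
  assumes \<alpha>: "\<And>j. j \<in> opts I \<Longrightarrow> \<alpha> j \<ge> 0"
    and \<beta>: "\<And>t. t \<in> lp_times I \<Longrightarrow> \<beta> t \<ge> 0"
    and red: "\<And>j t. j \<in> opts I \<Longrightarrow> t \<in> lp_times I \<Longrightarrow> reduced_cost I \<alpha> \<beta> j t \<ge> 0"
    and y: "lp_feasible I y"
    and y_use: "\<And>j. j \<in> opts I \<Longrightarrow> \<alpha> j \<noteq> 0 \<Longrightarrow> lp_use I y j = 1"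
    and y_load: "\<And>t. t \<in> lp_times I \<Longrightarrow> \<beta> t \<noteq> 0 \<Longrightarrow> lp_load I y t = 1"
    and y_red: "\<And>j t. j \<in> opts I \<Longrightarrow> t \<in> lp_times I \<Longrightarrow> reduced_cost I \<alpha> \<beta> j t \<noteq> 0 \<Longrightarrow> y j t = 0"
    and x: "lp_optimal I x"
  shows "\<And>j. j \<in> opts I \<Longrightarrow> \<alpha> j \<noteq> 0 \<Longrightarrow> lp_use I x j = 1"
    and "\<And>j t. j \<in> opts I \<Longrightarrow> t \<in> lp_times I \<Longrightarrow> reduced_cost I \<alpha> \<beta> j t \<noteq> 0 \<Longrightarrow> x j t = 0"
proof -
  define U where "U = (\<lambda>z. \<Sum>j\<in>opts I. \<alpha> j * (1 - lp_use I z j))"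
  define L where "L = (\<lambda>z. \<Sum>t\<in>lp_times I. \<beta> t * (1 - lp_load I z t))"
  define R where "R = (\<lambda>z. \<Sum>j\<in>opts I. \<Sum>t\<in>lp_times I. reduced_cost I \<alpha> \<beta> j t * z j t)"
  \<comment> \<open>\<open>U z + L z + R z\<close> is the duality gap at \<open>z\<close>; the two
    sums before it form the dual objective.\<close>
  have gap: "lp_objective I z = sum \<alpha> (opts I) + sum \<beta> (lp_times I) - (U z + L z + R z)" for z
    unfolding U_def L_def R_def
    by (subst lp_objective_eq_dual[of I z \<alpha> \<beta>]) (simp add: algebra_simps sum_subtractf)
  have "U y = 0" unfolding U_def
    using y_use by (intro sum.neutral) force
  moreover have "L y = 0" unfolding L_def
    using y_load by (intro sum.neutral) force
  moreover have "R y = 0" unfolding R_def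
    using y_red by (intro sum.neutral ballI) force
  ultimately have le: "U x + L x + R x \<le> 0"
    using x y gap[of x] gap[of y] by (force simp: lp_optimal_def)
  have fx: "lp_feasible I x" using x by (simp add: lp_optimal_def)
  have U: "\<And>j. j \<in> opts I \<Longrightarrow> 0 \<le> \<alpha> j * (1 - lp_use I x j)"
    using fx \<alpha> by (simp add: lp_feasible_def lp_use_def)
  have L: "\<And>t. t \<in> lp_times I \<Longrightarrow> 0 \<le> \<beta> t * (1 - lp_load I x t)"
    using fx \<beta> by (simp add: lp_feasible_def lp_load_def)
  have R: "\<And>j t. j \<in> opts I \<Longrightarrow> t \<in> lp_times I \<Longrightarrow> 0 \<le> reduced_cost I \<alpha> \<beta> j t * x j t"
    using fx red by (simp add: lp_feasible_def)
  have RS: "0 \<le> (\<Sum>t\<in>lp_times I. reduced_cost I \<alpha> \<beta> j t * x j t)" if "j \<in> opts I" for j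
    using R[OF that] by (rule sum_nonneg)
  have "U x \<ge> 0" "L x \<ge> 0" "R x \<ge> 0"
    unfolding U_def L_def R_def by (rule sum_nonneg, fact)+
  with le have "U x = 0" "R x = 0" by auto
  from \<open>U x = 0\<close> have "\<forall>j\<in>opts I. \<alpha> j * (1 - lp_use I x j) = 0"
    unfolding U_def by (subst (asm) sum_nonneg_eq_0_iff) (rule finite_atLeastAtMost, fact U, assumption)
  then show "\<And>j. j \<in> opts I \<Longrightarrow> \<alpha> j \<noteq> 0 \<Longrightarrow> lp_use I x j = 1"
    by (metis eq_iff_diff_eq_0 mult_eq_0_iff)
  show "x j t = 0" if jt: "j \<in> opts I" "t \<in> lp_times I" and red: "reduced_cost I \<alpha> \<beta> j t \<noteq> 0" for j t
  proof -
    from \<open>R x = 0\<close> have "\<forall>j\<in>opts I. (\<Sum>t\<in>lp_times I. reduced_cost I \<alpha> \<beta> j t * x j t) = 0"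
      unfolding R_def by (subst (asm) sum_nonneg_eq_0_iff) (rule finite_atLeastAtMost, fact RS, assumption)
    then have "(\<Sum>t\<in>lp_times I. reduced_cost I \<alpha> \<beta> j t * x j t) = 0"
      using jt(1) ..
    then have "\<forall>t\<in>lp_times I. reduced_cost I \<alpha> \<beta> j t * x j t = 0"
      by (subst (asm) sum_nonneg_eq_0_iff) (rule finite_atLeastAtMost, fact R[OF jt(1)], assumption)
    then show ?thesis using jt(2) red by (metis mult_eq_0_iff)
  qed
qed


section \<open>The value of the algorithm\<close>

lemma set_pmf_stepD:
  assumes "s' \<in> set_pmf (step I sel t q s)" "s' \<noteq> s"
  obtains A where "A \<noteq> {}" "A \<subseteq> candidates I t s"
    "s' = s\<lparr>considered := considered s \<union> A, selected := insert (sel t A) (selected s),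
            free_at := t + evals s (sel t A)\<rparr>"
proof -
  let ?upd = "\<lambda>A. s\<lparr>considered := considered s \<union> A, selected := insert (sel t A) (selected s),
      free_at := t + evals s (sel t A)\<rparr>"
  have "free_at s \<le> t"
    using assms by (auto simp: step_def split: if_splits)
  with assms(1) obtain b where b: "s' = (if {j \<in> candidates I t s. b j} = {} then s
      else ?upd {j \<in> candidates I t s. b j})"
    by (simp only: step_def Let_def set_bind_pmf set_return_pmf if_True UN_iff singleton_iff) blast
  with assms(2) have ne: "{j \<in> candidates I t s. b j} \<noteq> {}"
    by (metis (no_types, lifting))
  show ?thesis
  proof (rule that)
    show "s' = ?upd {j \<in> candidates I t s. b j}"
      using b unfolding if_not_P[OF ne] .
  qed (use ne in auto)
qed

lemma candidates_subset: "candidates I t s \<subseteq> opts I"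
  by (auto simp: candidates_def)

lemma max_selector_mem:
  "max_selector I sel \<Longrightarrow> A \<noteq> {} \<Longrightarrow> A \<subseteq> opts I \<Longrightarrow> sel t A \<in> A"
  by (simp add: max_selector_def)

text \<open>The hypothesis ranges over every \<open>q\<close> because the probabilities actually
  used are computed from the law of the state reached so far; looking at supports avoids computing
  with them.\<close>

lemma map_alg_law_Suc_eq:
  assumes "\<And>s q s'. s' \<in> set_pmf (step I sel (Suc k) q s) \<Longrightarrow> h s' = h s"
  shows "map_pmf h (alg_law I x sel (Suc k)) = map_pmf h (alg_law I x sel k)"
proof -
  have "map_pmf h (step I sel (Suc k) q s) = return_pmf (h s)" for q s
    using assms by (subst map_pmf_cong[OF refl, of _ h "\<lambda>_. h s"]) auto
  then show ?thesis
    by (simp add: Let_def map_bind_pmf flip: map_pmf_def)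
qed

text \<open>Expiration times are drawn at the start, and no step touches them.\<close>

lemma map_exps_alg_law: "map_pmf exps (alg_law I x sel k) = Pi_pmf (opts I) 0 (exp_time I)"
proof (induction k)
  case 0
  show ?case
    by (simp add: init_law_def map_bind_pmf bind_return_pmf')
next
  case (Suc k)
  have "exps s' = exps s" if "s' \<in> set_pmf (step I sel (Suc k) q s)" for s s' q
    using that by (cases "s' = s") (auto elim: set_pmf_stepD)
  from map_alg_law_Suc_eq[OF this] Suc show ?case by simp
qed

lemma selected_subset_opts:
  assumes sel: "max_selector I sel" and "s \<in> set_pmf (alg_law I x sel k)"
  shows "selected s \<subseteq> opts I"
  using assms(2)
proof (induction k arbitrary: s)
  case 0
  then show ?case by (auto simp: init_law_def)
next
  case (Suc k)
  then obtain s0 q where s0: "s0 \<in> set_pmf (alg_law I x sel k)"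
    and s: "s \<in> set_pmf (step I sel (Suc k) q s0)"
    by (auto simp: Let_def)
  show ?case
  proof (cases "s = s0")
    case False
    from s this show ?thesis
    proof (rule set_pmf_stepD)
      fix A assume A: "A \<noteq> {}" "A \<subseteq> candidates I (Suc k) s0" and eq: "s = s0
        \<lparr>considered := considered s0 \<union> A, selected := insert (sel (Suc k) A) (selected s0),
         free_at := Suc k + evals s0 (sel (Suc k) A)\<rparr>"
      have "sel (Suc k) A \<in> opts I"
        using max_selector_mem[OF sel A(1)] A(2) candidates_subset by blast
      with Suc.IH[OF s0] eq show ?thesis by simp
    qed
  qed (use Suc.IH s0 in auto)
qed

lemma selected_step_mono: "s' \<in> set_pmf (step I sel t q s) \<Longrightarrow> selected s \<subseteq> selected s'"
  by (cases "s' = s") (auto elim: set_pmf_stepD)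

section \<open>Monotonicity and boundedness of the expected value\<close>

lemma expectation_mono_pmf:
  fixes f g :: "'a \<Rightarrow> real"
  assumes "\<And>s. s \<in> set_pmf \<mu> \<Longrightarrow> f s \<le> g s"
    and "\<And>s. s \<in> set_pmf \<mu> \<Longrightarrow> \<bar>f s\<bar> \<le> B" "\<And>s. s \<in> set_pmf \<mu> \<Longrightarrow> \<bar>g s\<bar> \<le> B"
  shows "measure_pmf.expectation \<mu> f \<le> measure_pmf.expectation \<mu> g"
  using assms
  by (intro integral_mono_AE measure_pmf.integrable_const_bound[where B = B])
     (auto simp: AE_measure_pmf_iff)

lemma sum_subset_bounds:
  fixes f :: "nat \<Rightarrow> real"
  assumes "A \<subseteq> B" "finite B" "\<And>j. j \<in> B \<Longrightarrow> f j \<ge> 0"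
  shows "\<bar>sum f A\<bar> \<le> sum f B"
proof -
  have "0 \<le> sum f A" using assms by (intro sum_nonneg) auto
  moreover have "sum f A \<le> sum f B" using assms by (intro sum_mono2) auto
  ultimately show ?thesis by simp
qed

lemma val_nonneg: "sse_instance I \<Longrightarrow> j \<in> opts I \<Longrightarrow> val I j \<ge> 0"
  by (auto simp: sse_instance_def intro: less_imp_le)

lemma alg_law_value_bounded:
  assumes "sse_instance I" "max_selector I sel" "s \<in> set_pmf (alg_law I x sel k)"
  shows "\<bar>\<Sum>j\<in>selected s. val I j\<bar> \<le> (\<Sum>j\<in>opts I. val I j)"
  using assms selected_subset_opts[OF assms(2,3)] val_nonneg[OF assms(1)]
  by (intro sum_subset_bounds) auto

text \<open>The states before and after the step are drawn jointly, as the coupling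
  \<open>J\<close>. On its support \<open>selected\<close> only grows, and values are
  nonnegative.\<close>

lemma expectation_alg_law_mono:
  assumes I: "sse_instance I" and sel: "max_selector I sel"
  shows "measure_pmf.expectation (alg_law I x sel k) (\<lambda>s. \<Sum>j\<in>selected s. val I j)
    \<le> measure_pmf.expectation (alg_law I x sel (Suc k)) (\<lambda>s. \<Sum>j\<in>selected s. val I j)"
proof -
  let ?v = "\<lambda>s. \<Sum>j\<in>selected s. val I j"
  define \<mu> where "\<mu> = alg_law I x sel k"
  define q where "q = consider_prob I x (Suc k) \<mu>"
  define J where "J = bind_pmf \<mu> (\<lambda>s. map_pmf (Pair s) (step I sel (Suc k) q s))"
  have fst: "map_pmf fst J = \<mu>"
    by (simp add: J_def map_bind_pmf pmf.map_comp o_def bind_return_pmf')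
  have snd: "map_pmf snd J = alg_law I x sel (Suc k)"
    by (simp add: J_def map_bind_pmf pmf.map_comp o_def \<mu>_def q_def Let_def)
  have mem: "fst p \<in> set_pmf \<mu>" "snd p \<in> set_pmf (alg_law I x sel (Suc k))" if "p \<in> set_pmf J" for p
    using that unfolding fst[symmetric] snd[symmetric] by auto
  have mono: "?v (fst p) \<le> ?v (snd p)" if p: "p \<in> set_pmf J" for p
  proof (rule sum_mono2)
    show "selected (fst p) \<subseteq> selected (snd p)"
      using p by (auto simp: J_def intro: selected_step_mono[THEN subsetD])
    have "selected (snd p) \<subseteq> opts I"
      by (rule selected_subset_opts[OF sel mem(2)[OF p]])
    then show "finite (selected (snd p))"
      "\<And>b. b \<in> selected (snd p) - selected (fst p) \<Longrightarrow> 0 \<le> val I b"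
      using val_nonneg[OF I] by (auto intro: finite_subset)
  qed
  have "measure_pmf.expectation (map_pmf fst J) ?v \<le> measure_pmf.expectation (map_pmf snd J) ?v"
    unfolding integral_map_pmf
    using mono mem alg_law_value_bounded[OF I sel] unfolding \<mu>_def
    by (intro expectation_mono_pmf[where B = "\<Sum>j\<in>opts I. val I j"]) blast+
  then show ?thesis by (simp only: fst snd \<mu>_def)
qed

text \<open>\<open>lim\<close> is informative only for a convergent sequence, so convergence is
  derived first, from monotonicity and the bound. Asking for \<open>k \<ge> 1\<close> suits bounds
  that speak of time 1; \<open>k = 0\<close> follows by monotonicity.\<close>

lemma alg_value_le:
  assumes I: "sse_instance I" and sel: "max_selector I sel"
    and le: "\<And>k. k \<ge> 1 \<Longrightarrow>
      measure_pmf.expectation (alg_law I x sel k) (\<lambda>s. \<Sum>j\<in>selected s. val I j) \<le> B"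
  shows "alg_value I x sel \<le> B"
proof -
  let ?e = "\<lambda>k. measure_pmf.expectation (alg_law I x sel k) (\<lambda>s. \<Sum>j\<in>selected s. val I j)"
  have inc: "incseq ?e"
    using expectation_alg_law_mono[OF I sel] by (intro incseq_SucI)
  have "?e k \<le> B" for k
    using le[of "Suc k"] expectation_alg_law_mono[OF I sel, of x k] by simp
  with inc obtain l where l: "?e \<longlonglongrightarrow> l" "\<And>k. ?e k \<le> l"
    using incseq_convergent[of ?e B] by blast
  moreover have "l \<le> B"
    using l(1) \<open>\<And>k. ?e k \<le> B\<close> by (intro LIMSEQ_le_const2[OF l(1)]) auto
  ultimately show ?thesis
    unfolding alg_value_def by (simp add: limI)
qed

text \<open>An option selected after time 1 must still be alive at time 2, so for \<open>k \<ge> 1\<close> this set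
  is settled at time 1.\<close>

definition early :: "state \<Rightarrow> nat set" where
  "early s = {j \<in> selected s. exps s j \<le> 2}"

lemma map_early_alg_law:
  assumes sel: "max_selector I sel" and "k \<ge> 1"
  shows "map_pmf early (alg_law I x sel k) = map_pmf early (alg_law I x sel 1)"
  using \<open>k \<ge> 1\<close>
proof (induction k rule: nat_induct_at_least)
  case (Suc k)
  have "early s' = early s" if s': "s' \<in> set_pmf (step I sel (Suc k) q s)" for s s' q
  proof (cases "s' = s")
    case False
    from s' this show ?thesis
    proof (rule set_pmf_stepD)
      fix A assume A: "A \<noteq> {}" "A \<subseteq> candidates I (Suc k) s" and eq: "s' = s
        \<lparr>considered := considered s \<union> A, selected := insert (sel (Suc k) A) (selected s),
         free_at := Suc k + evals s (sel (Suc k) A)\<rparr>"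
      have "sel (Suc k) A \<in> candidates I (Suc k) s"
        using max_selector_mem[OF sel A(1)] A(2) candidates_subset by blast
      \<comment> \<open>Here \<open>Suc k \<ge> 2\<close>, and a candidate expires strictly later
        than the current time; hence the new selection never enters \<open>early\<close>.\<close>
      then have "exps s (sel (Suc k) A) > 2"
        using Suc.hyps by (auto simp: candidates_def)
      with eq show ?thesis by (auto simp: early_def)
    qed
  qed auto
  from map_alg_law_Suc_eq[OF this] Suc.IH show ?case by simp
qed auto

section \<open>The first time step\<close>

lemma init_law_support:
  assumes I: "sse_instance I" and s: "s \<in> set_pmf (init_law I)"
  shows "considered s = {}" "selected s = {}" "free_at s = 1" "candidates I 1 s = opts I"
    and "\<And>j. j \<in> opts I \<Longrightarrow> exps s j > 1"
proof -
  from s obtain S E where E: "E \<in> set_pmf (Pi_pmf (opts I) 0 (exp_time I))"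
    and eq: "s = \<lparr>evals = S, exps = E, considered = {}, selected = {}, free_at = 1\<rparr>"
    by (auto simp: init_law_def)
  show "considered s = {}" "selected s = {}" "free_at s = 1"
    using eq by auto
  show ex: "exps s j > 1" if j: "j \<in> opts I" for j
  proof -
    have "E j \<in> set_pmf (exp_time I j)"
      using E j by (auto simp: set_Pi_pmf PiE_dflt_def)
    moreover have "measure_pmf.prob (exp_time I j) {e. e > 1} = 1"
      using I j by (simp add: sse_instance_def surv_exp_def)
    then have "AE e in exp_time I j. e > 1"
      by (subst (asm) measure_pmf.prob_eq_1) simp_all
    ultimately show ?thesis
      using eq by (auto simp: AE_measure_pmf_iff)
  qed
  then show "candidates I 1 s = opts I"
    using eq by (auto simp: candidates_def)
qed

text \<open>Before time 1 nothing has been considered and the decision-maker is free, so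
  \<open>free_prob\<close> is 1, and so is the survival probability.\<close>

lemma consider_prob_1:
  assumes I: "sse_instance I" and j: "j \<in> opts I"
  shows "consider_prob I x 1 (init_law I) j = x j 1 / 2"
proof -
  have "AE s in init_law I. exps s j > 1" "AE s in init_law I. j \<notin> considered s \<and> free_at s \<le> 1 \<and> exps s j > 1"
    using init_law_support[OF I] j by (auto simp: AE_measure_pmf_iff)
  then have "measure_pmf.prob (init_law I) {s. exps s j > 1} = 1"
    "measure_pmf.prob (init_law I) {s. (j \<notin> considered s \<and> free_at s \<le> 1) \<and> exps s j > 1} = 1"
    by (subst measure_pmf.prob_eq_1; simp)+
  then have "free_prob 1 (init_law I) j = 1"
    by (simp add: free_prob_def cond_prob_def)
  moreover have "surv_exp I j 1 = 1"
    using I j by (simp add: sse_instance_def)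
  ultimately show ?thesis by (simp add: consider_prob_def)
qed

text \<open>At time 1 the candidates are always all of \<open>opts I\<close>, so the coins do not
  depend on the initial state and the law is the image of a product. Of the update only its effect
  on \<open>selected\<close> is exposed.\<close>

lemma alg_law_1_eq:
  assumes I: "sse_instance I"
  obtains upd where
    "alg_law I x sel 1 = map_pmf (\<lambda>(s, b). upd s b)
       (pair_pmf (init_law I) (Pi_pmf (opts I) False (\<lambda>j. bernoulli_pmf (x j 1 / 2))))"
    "\<forall>s\<in>set_pmf (init_law I). \<forall>b.
       selected (upd s b) = (if {j\<in>opts I. b j} = {} then {} else {sel 1 {j\<in>opts I. b j}})"
proof
  let ?upd = "\<lambda>s b. if {j\<in>opts I. b j} = {} then s
      else s\<lparr>considered := considered s \<union> {j\<in>opts I. b j},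
             selected := insert (sel 1 {j\<in>opts I. b j}) (selected s),
             free_at := 1 + evals s (sel 1 {j\<in>opts I. b j})\<rparr>"
  let ?P = "Pi_pmf (opts I) False (\<lambda>j. bernoulli_pmf (x j 1 / 2))"
  have P: "Pi_pmf (opts I) False (\<lambda>j. bernoulli_pmf (consider_prob I x 1 (init_law I) j)) = ?P"
    by (intro Pi_pmf_cong) (simp_all only: consider_prob_1[OF I] finite_atLeastAtMost)
  have "alg_law I x sel 1 = bind_pmf (init_law I) (step I sel 1 (consider_prob I x 1 (init_law I)))"
    using alg_law.simps(2)[of I x sel 0] by (simp add: Let_def One_nat_def)
  also have "\<dots> = bind_pmf (init_law I) (\<lambda>s. bind_pmf ?P (\<lambda>b. return_pmf (?upd s b)))"
    using init_law_support[OF I] P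
    by (intro bind_pmf_cong refl) (simp add: step_def Let_def del: atLeastAtMost_iff)
  also have "\<dots> = map_pmf (\<lambda>(s, b). ?upd s b) (pair_pmf (init_law I) ?P)"
    by (simp add: pair_pmf_def map_bind_pmf)
  finally show "alg_law I x sel 1 = map_pmf (\<lambda>(s, b). ?upd s b) (pair_pmf (init_law I) ?P)" .
  show "\<forall>s\<in>set_pmf (init_law I). \<forall>b.
      selected (?upd s b) = (if {j\<in>opts I. b j} = {} then {} else {sel 1 {j\<in>opts I. b j}})"
    using init_law_support(2)[OF I] by simp
qed

lemma prob_some_considered:
  assumes "finite C" "M \<subseteq> C" "\<And>j. j \<in> M \<Longrightarrow> 0 \<le> q j \<and> q j \<le> 1"
  shows "measure_pmf.prob (Pi_pmf C False (\<lambda>j. bernoulli_pmf (q j))) {b. \<exists>j\<in>M. b j}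
    = 1 - (\<Prod>j\<in>M. 1 - q j)"
proof -
  let ?P = "Pi_pmf C False (\<lambda>j. bernoulli_pmf (q j))"
  have "measure_pmf.prob ?P {b. \<forall>j\<in>M. \<not> b j} = measure_pmf.prob ?P (Pi C (\<lambda>j. if j \<in> M then {False} else UNIV))"
    using assms(2) by (intro arg_cong[where f = "measure_pmf.prob ?P"]) (auto simp: Pi_def)
  also have "\<dots> = (\<Prod>j\<in>C. if j \<in> M then 1 - q j else 1)"
    using assms by (subst measure_Pi_pmf_Pi) (auto simp: measure_pmf_single intro!: prod.cong)
  also have "\<dots> = (\<Prod>j\<in>M. 1 - q j)"
    using assms(1,2) by (subst prod.inter_restrict[symmetric]) (auto simp: Int_absorb1)
  finally have *: "measure_pmf.prob ?P {b. \<forall>j\<in>M. \<not> b j} = (\<Prod>j\<in>M. 1 - q j)" .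
  have "{b. \<exists>j\<in>M. b j} = UNIV - {b. \<forall>j\<in>M. \<not> b j}" by auto
  then show ?thesis
    using measure_pmf.prob_compl[of "{b. \<forall>j\<in>M. \<not> b j}" ?P] * by simp
qed

text \<open>\<open>early\<close> is frozen after time 1, when at most one option is selected. So the
  sum has at most one term, and it has one only if some coin of \<open>M\<close> came up.\<close>

lemma expectation_early_le:
  assumes I: "sse_instance I" and sel: "max_selector I sel" and "k \<ge> 1"
    and M: "M \<subseteq> opts I" and V: "\<And>j. j \<in> M \<Longrightarrow> val I j \<le> V" "V \<ge> 0"
    and x: "\<And>j. j \<in> M \<Longrightarrow> 0 \<le> x j 1 \<and> x j 1 \<le> 1"
  shows "measure_pmf.expectation (alg_law I x sel k) (\<lambda>s. \<Sum>j\<in>early s \<inter> M. val I j)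
    \<le> V * (1 - (\<Prod>j\<in>M. 1 - x j 1 / 2))"
proof -
  let ?P = "Pi_pmf (opts I) False (\<lambda>j. bernoulli_pmf (x j 1 / 2))"
  let ?g = "\<lambda>A. \<Sum>j\<in>A \<inter> M. val I j"
  obtain upd where law: "alg_law I x sel 1 = map_pmf (\<lambda>(s, b). upd s b) (pair_pmf (init_law I) ?P)"
    and upd: "\<forall>s\<in>set_pmf (init_law I). \<forall>b.
       selected (upd s b) = (if {j\<in>opts I. b j} = {} then {} else {sel 1 {j\<in>opts I. b j}})"
    by (rule alg_law_1_eq[OF I, where x = x and sel = sel])
  have pos: "0 \<le> ?g A" for A
    using val_nonneg[OF I] M by (intro sum_nonneg) auto
  have g_le: "?g (early (upd s b)) \<le> V * indicator {b. \<exists>j\<in>M. b j} b"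
    if s: "s \<in> set_pmf (init_law I)" for s b
  proof (cases "early (upd s b) \<inter> M = {}")
    case True
    then show ?thesis using V(2) by (simp add: indicator_def)
  next
    case False
    let ?A = "{j\<in>opts I. b j}"
    have sub: "early (upd s b) \<subseteq> selected (upd s b)"
      by (auto simp: early_def)
    with False have "selected (upd s b) \<noteq> {}" by blast
    with bspec[OF upd s, THEN spec, of b] have ne: "?A \<noteq> {}" and eq: "selected (upd s b) = {sel 1 ?A}"
      by metis+
    have *: "early (upd s b) \<inter> M = {sel 1 ?A}" "sel 1 ?A \<in> M"
      using False sub unfolding eq by blast+
    \<comment> \<open>The rule picks from the consideration set, so the single early option, known
      to lie in \<open>M\<close>, was itself considered.\<close>
    have "sel 1 ?A \<in> ?A"
      using ne by (rule max_selector_mem[OF sel]) blast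
    then have "\<exists>j\<in>M. b j" using *(2) by blast
    then show ?thesis using * V by simp
  qed
  have "measure_pmf.expectation (alg_law I x sel k) (\<lambda>s. ?g (early s))
      = measure_pmf.expectation (map_pmf early (alg_law I x sel k)) ?g"
    by (simp add: integral_map_pmf)
  also have "\<dots> = measure_pmf.expectation (alg_law I x sel 1) (\<lambda>s. ?g (early s))"
    by (simp only: map_early_alg_law[OF sel \<open>k \<ge> 1\<close>] integral_map_pmf)
  also have "\<dots> = measure_pmf.expectation (pair_pmf (init_law I) ?P) (\<lambda>(s, b). ?g (early (upd s b)))"
    by (simp only: law integral_map_pmf) (simp add: case_prod_unfold)
  also have "\<dots> \<le> measure_pmf.expectation (pair_pmf (init_law I) ?P)
      (\<lambda>p. V * indicator {b. \<exists>j\<in>M. b j} (snd p))"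
  proof (rule expectation_mono_pmf[where B = V])
    fix p assume "p \<in> set_pmf (pair_pmf (init_law I) ?P)"
    then have *: "fst p \<in> set_pmf (init_law I)" by auto
    show "(case p of (s, b) \<Rightarrow> ?g (early (upd s b))) \<le> V * indicator {b. \<exists>j\<in>M. b j} (snd p)"
      using g_le[OF *] by (simp add: case_prod_unfold)
    moreover show "\<bar>V * indicator {b. \<exists>j\<in>M. b j} (snd p)\<bar> \<le> V"
      using V(2) by (simp add: indicator_def)
    ultimately show "\<bar>case p of (s, b) \<Rightarrow> ?g (early (upd s b))\<bar> \<le> V"
      using pos by (simp add: case_prod_unfold)
  qed
  also have "\<dots> = measure_pmf.expectation (map_pmf snd (pair_pmf (init_law I) ?P))
      (\<lambda>b. V * indicator {b. \<exists>j\<in>M. b j} b)"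
    by (simp only: integral_map_pmf)
  also have "\<dots> = V * measure_pmf.prob ?P {b. \<exists>j\<in>M. b j}"
    by (simp add: map_snd_pair_pmf)
  also have "\<dots> = V * (1 - (\<Prod>j\<in>M. 1 - x j 1 / 2))"
    using M x by (subst prob_some_considered) force+
  finally show ?thesis .
qed

lemma expectation_alive_at_2:
  assumes "j \<in> opts I"
  shows "measure_pmf.expectation (alg_law I x sel k) (\<lambda>s. indicator {s. exps s j > 2} s :: real)
    = surv_exp I j 2"
proof -
  have "map_pmf (\<lambda>s. exps s j) (alg_law I x sel k) = map_pmf (\<lambda>f. f j) (map_pmf exps (alg_law I x sel k))"
    by (simp add: pmf.map_comp o_def)
  also have "\<dots> = exp_time I j"
    using assms by (simp add: map_exps_alg_law Pi_pmf_component)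
  finally have "surv_exp I j 2 = measure_pmf.prob (map_pmf (\<lambda>s. exps s j) (alg_law I x sel k)) {e. e > 2}"
    by (simp add: surv_exp_def)
  then show ?thesis by (simp add: vimage_def)
qed


text \<open>The value is split three ways. Early options of \<open>M\<close> are bounded through the
  coins of time 1; options outside \<open>M\<close> are counted in full; any other selected option
  of \<open>M\<close> outlives time 2, and all options of \<open>M\<close> that do so are counted,
  selected or not.\<close>

lemma alg_value_le_time_1:
  assumes I: "sse_instance I" and sel: "max_selector I sel"
    and M: "M \<subseteq> opts I" and V: "\<And>j. j \<in> M \<Longrightarrow> val I j \<le> V" "V \<ge> 0"
    and x: "\<And>j. j \<in> M \<Longrightarrow> 0 \<le> x j 1 \<and> x j 1 \<le> 1"
  shows "alg_value I x sel \<le> V * (1 - (\<Prod>j\<in>M. 1 - x j 1 / 2))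
    + (\<Sum>j\<in>opts I - M. val I j) + (\<Sum>j\<in>M. V * surv_exp I j 2)"
proof (rule alg_value_le[OF I sel])
  fix k :: nat assume k: "k \<ge> 1"
  let ?\<mu> = "alg_law I x sel k"
  let ?g = "\<lambda>s. \<Sum>j\<in>early s \<inter> M. val I j"
  let ?c = "\<Sum>j\<in>opts I - M. val I j"
  let ?l = "\<lambda>s. \<Sum>j\<in>M. V * indicator {s. exps s j > 2} s"
  have finM: "finite M" using M finite_subset by blast
  have v: "\<And>j. j \<in> opts I \<Longrightarrow> val I j \<ge> 0" using val_nonneg[OF I] .
  have g: "\<bar>?g s\<bar> \<le> (\<Sum>j\<in>M. val I j)" for s
    using M v finM by (intro sum_subset_bounds) auto
  have l: "0 \<le> ?l s" "?l s \<le> (\<Sum>j\<in>M. V)" for s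
    using V(2) by (intro sum_nonneg sum_mono; simp add: indicator_def del: sum_constant)+
  have c: "?c \<ge> 0" using v by (intro sum_nonneg) auto
  have le: "(\<Sum>j\<in>selected s. val I j) \<le> ?g s + (?c + ?l s)" if s: "s \<in> set_pmf ?\<mu>" for s
  proof -
    have sub: "selected s \<subseteq> opts I" by (rule selected_subset_opts[OF sel s])
    have fin: "finite (selected s)" using sub finite_subset by blast
    have "(\<Sum>j\<in>selected s. val I j) = (\<Sum>j\<in>early s \<inter> M. val I j) + (\<Sum>j\<in>selected s - early s \<inter> M. val I j)"
      using fin by (subst sum.subset_diff[of "early s \<inter> M"]) (auto simp: early_def)
    also have "(\<Sum>j\<in>selected s - early s \<inter> M. val I j)
        \<le> (\<Sum>j\<in>(opts I - M) \<union> {j\<in>M. exps s j > 2}. val I j)"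
      using sub v M by (intro sum_mono2) (auto simp: early_def intro: finite_subset)
    also have "\<dots> = ?c + (\<Sum>j\<in>{j\<in>M. exps s j > 2}. val I j)"
      using finM by (intro sum.union_disjoint) auto
    also have "(\<Sum>j\<in>{j\<in>M. exps s j > 2}. val I j) \<le> (\<Sum>j\<in>{j\<in>M. exps s j > 2}. V)"
      using V by (intro sum_mono) auto
    also have "\<dots> = ?l s"
      unfolding sum.inter_filter[OF finM] by (intro sum.cong) auto
    finally show ?thesis by simp
  qed
  have ig: "integrable ?\<mu> ?g"
    using g by (intro measure_pmf.integrable_const_bound[where B = "\<Sum>j\<in>M. val I j"]) auto
  have il: "integrable ?\<mu> (\<lambda>s. V * indicator {s. exps s j > 2} s :: real)" for j
    using V(2) by (intro measure_pmf.integrable_const_bound[where B = V]) (auto simp: indicator_def)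
  have "measure_pmf.expectation ?\<mu> (\<lambda>s. \<Sum>j\<in>selected s. val I j)
      \<le> measure_pmf.expectation ?\<mu> (\<lambda>s. ?g s + (?c + ?l s))"
  proof (rule expectation_mono_pmf[where B = "(\<Sum>j\<in>opts I. val I j) + (\<Sum>j\<in>M. val I j) + (?c + (\<Sum>j\<in>M. V))"])
    fix s assume s: "s \<in> set_pmf ?\<mu>"
    show "(\<Sum>j\<in>selected s. val I j) \<le> ?g s + (?c + ?l s)" by (rule le[OF s])
    have "0 \<le> (\<Sum>j\<in>M. V)" using V(2) by (intro sum_nonneg) auto
    moreover have "0 \<le> (\<Sum>j\<in>opts I. val I j)" using v by (intro sum_nonneg) auto
    ultimately show "\<bar>\<Sum>j\<in>selected s. val I j\<bar> \<le> (\<Sum>j\<in>opts I. val I j) + (\<Sum>j\<in>M. val I j) + (?c + (\<Sum>j\<in>M. V))"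
      "\<bar>?g s + (?c + ?l s)\<bar> \<le> (\<Sum>j\<in>opts I. val I j) + (\<Sum>j\<in>M. val I j) + (?c + (\<Sum>j\<in>M. V))"
      using alg_law_value_bounded[OF I sel s] g[of s] l[of s] c by linarith+
  qed
  also have "\<dots> = measure_pmf.expectation ?\<mu> ?g + (?c + (\<Sum>j\<in>M. V * surv_exp I j 2))"
  proof -
    have "measure_pmf.expectation ?\<mu> ?l = (\<Sum>j\<in>M. V * surv_exp I j 2)"
      using M il by (subst Bochner_Integration.integral_sum)
        (auto intro!: sum.cong simp: expectation_alive_at_2[simplified] subset_iff)
    moreover have "integrable ?\<mu> ?l" using il by auto
    ultimately show ?thesis using ig by simp
  qed
  also have "measure_pmf.expectation ?\<mu> ?g \<le> V * (1 - (\<Prod>j\<in>M. 1 - x j 1 / 2))"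
    by (rule expectation_early_le[OF I sel k M V]) (assumption, rule x)
  finally show "measure_pmf.expectation ?\<mu> (\<lambda>s. \<Sum>j\<in>selected s. val I j)
      \<le> V * (1 - (\<Prod>j\<in>M. 1 - x j 1 / 2)) + ?c + (\<Sum>j\<in>M. V * surv_exp I j 2)"
    by simp
qed


section \<open>The instances\<close>

text \<open>With probability \<open>1 - r\<close> the option is gone after time 1. Otherwise it
  lives through time \<open>d\<close> for certain and then has a geometric tail, which keeps
  survival probabilities positive but divides them by 4 at each further time.\<close>

definition expiry :: "real \<Rightarrow> nat \<Rightarrow> nat pmf" where
  "expiry r d = map_pmf (\<lambda>(b, g). if b then d + 1 + g else 2)
     (pair_pmf (bernoulli_pmf r) (geometric_pmf (3/4)))"

lemma expiry_surv_1: "d \<ge> 1 \<Longrightarrow> measure_pmf.prob (expiry r d) {e. e > 1} = 1"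
  unfolding expiry_def by (subst measure_pmf.prob_eq_1) (auto simp: AE_measure_pmf_iff split: if_splits)

text \<open>From time 2 on only the surviving branch counts. Truncated subtraction covers the
  plateau: for \<open>t \<le> d\<close> the geometric event is certain.\<close>

lemma expiry_surv:
  assumes "t \<ge> 2" "0 \<le> r" "r \<le> 1"
  shows "measure_pmf.prob (expiry r d) {e. e > t}
    = r * measure_pmf.prob (geometric_pmf (3/4)) {t - d..}"
proof -
  have "(\<lambda>(b, g). if b then d + 1 + g else 2) -` {e. e > t} = {True} \<times> {t - d..}"
    using assms(1) by (auto split: if_splits)
  then show ?thesis
    using assms(2,3) unfolding expiry_def
    by (simp add: measure_pmf_prob_product measure_pmf_single)
qed

lemma expiry_surv_eq:
  assumes "2 \<le> t" "t \<le> d" "0 \<le> r" "r \<le> 1"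
  shows "measure_pmf.prob (expiry r d) {e. e > t} = r"
proof -
  have "{t - d..} = UNIV" using assms(2) by auto
  then show ?thesis using assms by (simp add: expiry_surv)
qed

text \<open>The factor 4 lost right after time \<open>d\<close> is what makes later use too
  expensive in the reduced costs.\<close>

lemma expiry_surv_le:
  assumes "d < t" "2 \<le> t" "0 \<le> r" "r \<le> 1"
  shows "measure_pmf.prob (expiry r d) {e. e > t} \<le> r / 4"
proof -
  have "{1..} = UNIV - {0::nat}" by auto
  then have "measure_pmf.prob (geometric_pmf (3/4)) {1..} = 1 / 4"
    using measure_pmf.prob_compl[of "{0}" "geometric_pmf (3/4)"] by (simp add: measure_pmf_single)
  moreover have "measure_pmf.prob (geometric_pmf (3/4)) {t - d..}
      \<le> measure_pmf.prob (geometric_pmf (3/4)) {1..}"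
    using assms(1) by (intro measure_pmf.finite_measure_mono) auto
  ultimately have "measure_pmf.prob (geometric_pmf (3/4)) {t - d..} \<le> 1 / 4"
    by simp
  from mult_left_mono[OF this assms(3)] show ?thesis
    using assms by (simp add: expiry_surv)
qed

lemma expiry_surv_pos:
  assumes "t \<ge> 1" "d \<ge> 1" "0 < r" "r \<le> 1"
  shows "measure_pmf.prob (expiry r d) {e. e > t} > 0"
proof (cases "t = 1")
  case False
  have "measure_pmf.prob (geometric_pmf (3/4)) {t - d..} > 0"
    by (intro measure_pmf_posI[of "t - d"]) (auto simp: set_pmf_geometric)
  then show ?thesis using False assms by (simp add: expiry_surv)
qed (use assms expiry_surv_1 in simp)

section \<open>Parameters and values of the instances\<close>

text \<open>Small enough that \<open>real n * rho n\<close> tends to 0, so the expected number of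
  main options outliving time 1 vanishes. The shift by 1 gives \<open>rho n \<le> 1 / 4\<close>
  already for \<open>n = 1\<close>.\<close>

definition rho :: "nat \<Rightarrow> real" where
  "rho n = 1 / (real n + 1)\<^sup>2"

text \<open>The optimal dual prices of the time constraints. That they decrease strictly from time 2 on
  makes every option prefer its last time before the expiration becomes likely.\<close>

definition price :: "nat \<Rightarrow> nat \<Rightarrow> real" where
  "price n t = (if t = 1 then 1 else if t \<le> n then 1 / ((real n)\<^sup>2 * real t) else 0)"

text \<open>Both the survival probability of the filler at time 2 and its mass there in the optimal
  solution: together with a main mass \<open>rho n * (1 - 1 / (real n - 1))\<close> it fills a time
  exactly.\<close>

definition fill_rate :: "nat \<Rightarrow> real" where
  "fill_rate n = 1 - rho n * (1 - 1 / (real n - 1))"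

text \<open>The values are those for which the reduced costs vanish where the intended solution is
  positive.\<close>

definition hard_instance :: "nat \<Rightarrow> sse" where
  "hard_instance n = \<lparr>num_opts = n,
     val = (\<lambda>j. if j = 1 then 1 / real n + (\<Sum>t=2..n. price n t)
                else (1 - rho n * price n j) / (1 - rho n)),
     eval_time = (\<lambda>j. return_pmf (if j = 1 then n else 1)),
     exp_time = (\<lambda>j. if j = 1 then expiry (fill_rate n) 2 else expiry (rho n) j),
     max_time = n\<rparr>"

lemma num_opts_hard [simp]: "num_opts (hard_instance n) = n"
  and max_time_hard [simp]: "max_time (hard_instance n) = n"
  and val_hard: "val (hard_instance n) j = (if j = 1 then 1 / real n + (\<Sum>t=2..n. price n t)
                else (1 - rho n * price n j) / (1 - rho n))"
  and surv_eval_hard: "surv_eval (hard_instance n) j t = (if t < (if j = 1 then n else 1) then 1 else 0)"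
  and surv_exp_hard: "surv_exp (hard_instance n) j t = (if j = 1
    then measure_pmf.prob (expiry (fill_rate n) 2) {e. e > t}
    else measure_pmf.prob (expiry (rho n) j) {e. e > t})"
  by (simp_all add: hard_instance_def surv_eval_def surv_exp_def)

lemma rho_bounds: "n \<ge> 1 \<Longrightarrow> 0 < rho n \<and> rho n \<le> 1 / 4"
proof -
  assume "n \<ge> 1"
  then have "2\<^sup>2 \<le> (real n + 1)\<^sup>2" by (intro power_mono) auto
  then show ?thesis by (auto simp: rho_def field_simps)
qed

lemma fill_rate_bounds: "n \<ge> 1 \<Longrightarrow> 0 < fill_rate n \<and> fill_rate n \<le> 1"
proof -
  assume n: "n \<ge> 1"
  \<comment> \<open>For \<open>n = 1\<close> the quotient is a division by zero with value 0, so
    both bounds hold there too.\<close>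
  have c: "0 \<le> 1 / (real n - 1)" "1 / (real n - 1) \<le> 1"
    using n by (auto simp: divide_le_eq)
  have "rho n * (1 - 1 / (real n - 1)) \<le> (1 / 4) * 1" "0 \<le> rho n * (1 - 1 / (real n - 1))"
    using c rho_bounds[OF n] by (intro mult_mono mult_nonneg_nonneg; simp)+
  then show ?thesis unfolding fill_rate_def by linarith
qed

lemma price_nonneg: "price n t \<ge> 0"
  by (simp add: price_def)

lemma price_le: "2 \<le> t \<Longrightarrow> price n t \<le> 1 / (real n)\<^sup>2"
  by (auto simp: price_def intro!: divide_left_mono)

lemma price_le_quarter:
  assumes "2 \<le> t" "2 \<le> n" shows "price n t \<le> 1 / 4"
proof -
  have "4 \<le> (real n)\<^sup>2" using power_mono[of 2 "real n" 2] assms by simp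
  then have "1 / (real n)\<^sup>2 \<le> 1 / 4" by (intro frac_le) auto
  then show ?thesis using price_le[OF assms(1), of n] by simp
qed

lemma price_strict_decreasing:
  "2 \<le> s \<Longrightarrow> s < t \<Longrightarrow> t \<le> n \<Longrightarrow> price n t < price n s"
  by (simp add: price_def divide_strict_left_mono)

text \<open>There are \<open>n - 1\<close> terms of size at most
  \<open>1 / (real n)\<^sup>2\<close>. This keeps the value of the filler below
  \<open>2 / real n\<close>, up to equality, hence negligible.\<close>

lemma sum_price_le:
  assumes "n \<ge> 1" shows "(\<Sum>t=2..n. price n t) \<le> 1 / real n"
proof -
  have "(\<Sum>t=2..n. price n t) \<le> (\<Sum>t=2..n. 1 / (real n)\<^sup>2)"
    by (intro sum_mono price_le) auto
  also have "\<dots> = (real n - 1) / (real n)\<^sup>2"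
    using assms by (simp add: of_nat_diff)
  also have "\<dots> \<le> real n / (real n)\<^sup>2"
    by (intro divide_right_mono) auto
  also have "\<dots> = 1 / real n"
    using assms by (simp add: power2_eq_square)
  finally show ?thesis .
qed

lemma sse_instance_hard:
  assumes n: "n \<ge> 1"
  shows "sse_instance (hard_instance n)"
  unfolding sse_instance_def
proof (intro ballI conjI allI impI)
  fix j assume j: "j \<in> opts (hard_instance n)"
  have r: "0 < rho n" "rho n \<le> 1 / 4" using rho_bounds[OF n] by auto
  have c: "0 < fill_rate n" "fill_rate n \<le> 1" using fill_rate_bounds[OF n] by auto
  show "val (hard_instance n) j > 0"
  proof (cases "j = 1")
    case True
    have "(\<Sum>t=2..n. price n t) \<ge> 0" by (intro sum_nonneg price_nonneg)
    then show ?thesis using True n by (simp add: val_hard add_pos_nonneg)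
  next
    case False
    then have "price n j \<le> 1 / 4" using j by (intro price_le_quarter) auto
    then have "rho n * price n j \<le> 1 / 4 * (1 / 4)"
      using r price_nonneg by (intro mult_mono) auto
    then show ?thesis using False r by (simp add: val_hard)
  qed
  show "set_pmf (eval_time (hard_instance n) j) \<subseteq> {1..}"
    using n by (simp add: hard_instance_def)
  show "set_pmf (exp_time (hard_instance n) j) \<subseteq> {1..}"
    by (auto simp: hard_instance_def expiry_def split: if_splits)
  show "surv_eval (hard_instance n) j (max_time (hard_instance n)) = 0"
    using n by (simp add: surv_eval_hard)
  show "surv_exp (hard_instance n) j 1 = 1"
    using j expiry_surv_1 by (simp add: surv_exp_hard)
  show "surv_exp (hard_instance n) j t > 0" if "t \<ge> 1" for t
    using j that r c by (simp add: surv_exp_hard expiry_surv_pos)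
qed

text \<open>A main option loads only the time of its selection, whereas the filler also loads the
  \<open>n - 1\<close> times after it.\<close>

lemma lp_load_hard:
  assumes "n \<ge> 1" "t \<ge> 1"
  shows "lp_load (hard_instance n) x t
    = (\<Sum>\<tau>=1..t. if t - \<tau> < n then x 1 \<tau> else 0) + (\<Sum>j=2..n. x j t)"
proof -
  have "lp_load (hard_instance n) x t
      = (\<Sum>j\<in>{1..n}. \<Sum>\<tau>=1..t. surv_eval (hard_instance n) j (t - \<tau>) * x j \<tau>)"
    unfolding lp_load_def num_opts_hard by (rule sum.swap)
  also have "{1..n} = insert 1 {2..n}" using assms by auto
  also have "(\<Sum>j\<in>insert 1 {2..n}. \<Sum>\<tau>=1..t. surv_eval (hard_instance n) j (t - \<tau>) * x j \<tau>)
      = (\<Sum>\<tau>=1..t. surv_eval (hard_instance n) 1 (t - \<tau>) * x 1 \<tau>)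
        + (\<Sum>j=2..n. \<Sum>\<tau>=1..t. surv_eval (hard_instance n) j (t - \<tau>) * x j \<tau>)"
    by (intro sum.insert) auto
  also have "(\<Sum>\<tau>=1..t. surv_eval (hard_instance n) 1 (t - \<tau>) * x 1 \<tau>)
      = (\<Sum>\<tau>=1..t. if t - \<tau> < n then x 1 \<tau> else 0)"
    by (intro sum.cong) (auto simp: surv_eval_hard)
  also have "(\<Sum>j=2..n. \<Sum>\<tau>=1..t. surv_eval (hard_instance n) j (t - \<tau>) * x j \<tau>) = (\<Sum>j=2..n. x j t)"
  proof (rule sum.cong[OF refl])
    fix j assume "j \<in> {2..n}"
    then have "(\<Sum>\<tau>=1..t. surv_eval (hard_instance n) j (t - \<tau>) * x j \<tau>)
        = (\<Sum>\<tau>=1..t. if \<tau> = t then x j \<tau> else 0)"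
      by (intro sum.cong) (auto simp: surv_eval_hard)
    then show "(\<Sum>\<tau>=1..t. surv_eval (hard_instance n) j (t - \<tau>) * x j \<tau>) = x j t"
      using assms by simp
  qed
  finally show ?thesis .
qed

section \<open>Dual prices of the options and signs of the reduced costs\<close>

text \<open>With \<open>v\<close> the value of main option \<open>j\<close>, its entry
  \<open>a\<close> solves \<open>a + 1 = v\<close> and \<open>a / rho n + price n j = v\<close>,
  which are zero reduced cost at times 1 and \<open>j\<close>. The entry of the filler does the same
  at time 2.\<close>

definition dual :: "nat \<Rightarrow> nat \<Rightarrow> real" where
  "dual n j = (if j = 1 then fill_rate n / real n else rho n * (1 - price n j) / (1 - rho n))"

lemma reduced_cost_main:
  assumes j: "2 \<le> j" and t: "1 \<le> t" "t \<le> n * n"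
  shows "reduced_cost (hard_instance n) (dual n) (price n) j t
    = dual n j / surv_exp (hard_instance n) j t + price n t - val (hard_instance n) j"
proof -
  have "(\<Sum>s=t..n * n. surv_eval (hard_instance n) j (s - t) * price n s)
      = (\<Sum>s=t..n * n. if s = t then price n s else 0)"
    using j by (intro sum.cong) (auto simp: surv_eval_hard)
  then show ?thesis using t by (simp add: reduced_cost_def)
qed

text \<open>Prices vanish after time \<open>n\<close>, and an evaluation of length \<open>n\<close>
  begun at \<open>t \<ge> 1\<close> covers all of \<open>{t..n}\<close>; so the filler pays the
  whole remaining tail of prices.\<close>

lemma reduced_cost_filler:
  assumes n: "1 \<le> n" and t: "1 \<le> t"
  shows "reduced_cost (hard_instance n) (dual n) (price n) 1 t
    = fill_rate n / real n / surv_exp (hard_instance n) 1 t + (\<Sum>s=t..n. price n s)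
      - val (hard_instance n) 1"
proof -
  have "(\<Sum>s=t..n * n. surv_eval (hard_instance n) 1 (s - t) * price n s) = (\<Sum>s=t..n. price n s)"
    using n t by (intro sum.mono_neutral_cong_right) (auto simp: surv_eval_hard price_def)
  then show ?thesis by (simp add: reduced_cost_def dual_def)
qed

text \<open>From time 2 to \<open>j\<close> the survival probability is constantly
  \<open>rho n\<close>, so the reduced cost is \<open>price n t - price n j\<close>, positive before
  \<open>j\<close>. After \<open>j\<close> the term with \<open>dual n j\<close> is at least
  quadrupled and alone exceeds the value.\<close>

lemma reduced_cost_main_sign:
  assumes n: "2 \<le> n" and j: "2 \<le> j" "j \<le> n" and t: "1 \<le> t" "t \<le> n * n"
  shows "if t = 1 \<or> t = j then reduced_cost (hard_instance n) (dual n) (price n) j t = 0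
         else reduced_cost (hard_instance n) (dual n) (price n) j t > 0"
proof -
  have r: "0 < rho n" "rho n \<le> 1 / 4" using rho_bounds n by auto
  have d: "0 \<le> price n j" "price n j \<le> 1 / 4" using price_nonneg price_le_quarter j n by auto
  note rc = reduced_cost_main[OF j(1) t]
  have alive: "dual n j / surv_exp (hard_instance n) j t - val (hard_instance n) j = - price n j"
    if "2 \<le> t" "t \<le> j"
  proof -
    have "dual n j / surv_exp (hard_instance n) j t - val (hard_instance n) j
        = ((1 - price n j) - (1 - rho n * price n j)) / (1 - rho n)"
      using j r that by (simp add: surv_exp_hard expiry_surv_eq val_hard dual_def diff_divide_distrib)
    also have "(1 - price n j) - (1 - rho n * price n j) = - price n j * (1 - rho n)"
      by (simp add: algebra_simps)
    finally show ?thesis using r by simp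
  qed
  consider "t = 1" | "t = j" | "2 \<le> t" "t < j" | "j < t" using t by linarith
  then show ?thesis
  proof cases
    case 1
    then show ?thesis
      using j r expiry_surv_1[of j "rho n"] unfolding rc
      by (simp add: surv_exp_hard val_hard dual_def price_def[of n 1]) (simp add: field_simps)
  next
    case 2
    then show ?thesis using alive j unfolding rc by simp
  next
    case 3
    then show ?thesis
      using alive price_strict_decreasing[of t j n] j unfolding rc by simp
  next
    case 4
    have p: "0 < surv_exp (hard_instance n) j t" "surv_exp (hard_instance n) j t \<le> rho n / 4"
      using 4 j t r expiry_surv_le[of j t "rho n"] by (simp_all add: surv_exp_hard expiry_surv_pos)
    have "dual n j > 0" using j r d by (simp add: dual_def)
    then have "dual n j / (rho n / 4) \<le> dual n j / surv_exp (hard_instance n) j t"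
      using p r by (intro divide_left_mono mult_pos_pos) auto
    moreover have "dual n j / (rho n / 4) = 4 * (1 - price n j) / (1 - rho n)"
      using j r by (simp add: dual_def)
    moreover have "val (hard_instance n) j < 4 * (1 - price n j) / (1 - rho n)"
    proof -
      have "1 - rho n * price n j \<le> 1" using r d by simp
      also have "1 < 4 * (1 - price n j)" using d by simp
      finally show ?thesis using j r by (simp add: val_hard divide_strict_right_mono)
    qed
    ultimately show ?thesis using 4 j price_nonneg[of n t] unfolding rc by simp
  qed
qed

text \<open>Starting at time 1 would cost the extra price 1. From time 3 on the drop in survival
  raises the first term to at least \<open>4 / real n\<close>, above the filler's value.\<close>

lemma reduced_cost_filler_sign:
  assumes n: "2 \<le> n" and t: "1 \<le> t"
  shows "if t = 2 then reduced_cost (hard_instance n) (dual n) (price n) 1 t = 0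
         else reduced_cost (hard_instance n) (dual n) (price n) 1 t > 0"
proof -
  have n1: "1 \<le> n" using n by simp
  have c: "0 < fill_rate n" "fill_rate n \<le> 1" using fill_rate_bounds[OF n1] by auto
  note rc = reduced_cost_filler[OF n1 t]
  consider "t = 1" | "t = 2" | "t \<ge> 3" using t by linarith
  then show ?thesis
  proof cases
    case 1
    have "(\<Sum>s=1..n. price n s) = 1 + (\<Sum>s=2..n. price n s)"
      using n by (simp add: sum.atLeast_Suc_atMost price_def numeral_2_eq_2 One_nat_def)
    moreover have "1 / real n < 1" "0 < fill_rate n / real n" using n c by auto
    ultimately show ?thesis
      using 1 expiry_surv_1[of 2] unfolding rc by (simp add: surv_exp_hard val_hard)
  next
    case 2
    then show ?thesis
      using c unfolding rc by (simp add: surv_exp_hard val_hard expiry_surv_eq)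
  next
    case 3
    have p: "0 < surv_exp (hard_instance n) 1 t" "surv_exp (hard_instance n) 1 t \<le> fill_rate n / 4"
      using 3 c expiry_surv_le[of 2 t "fill_rate n"] by (simp_all add: surv_exp_hard expiry_surv_pos)
    have "fill_rate n / real n / (fill_rate n / 4) \<le> fill_rate n / real n / surv_exp (hard_instance n) 1 t"
      using p c n by (intro divide_left_mono mult_pos_pos) auto
    moreover have "fill_rate n / real n / (fill_rate n / 4) = 4 / real n"
      using c by simp
    moreover have "(\<Sum>s=t..n. price n s) \<ge> 0" by (intro sum_nonneg price_nonneg)
    moreover have "1 / real n + (\<Sum>s=2..n. price n s) < 4 / real n"
      using sum_price_le[OF n1] n by (simp add: field_simps)
    ultimately show ?thesis
      using 3 unfolding rc val_hard by simp
  qed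
qed

section \<open>The intended optimal solution\<close>

definition spread_solution :: "nat \<Rightarrow> nat \<Rightarrow> nat \<Rightarrow> real" where
  "spread_solution n j t =
     (if j = 1 then if t = 2 then fill_rate n else 0
      else if 2 \<le> j \<and> j \<le> n then
        if t = 1 then 1 / (real n - 1) else if t = j then rho n * (1 - 1 / (real n - 1)) else 0
      else 0)"

text \<open>The survival probabilities at times 1 and \<open>j\<close> are 1 and
  \<open>rho n\<close>. Only the support of \<open>x\<close> is restricted, so that the formula
  serves the intended solution and an arbitrary optimum alike.\<close>

lemma lp_use_main:
  assumes n: "2 \<le> n" and j: "2 \<le> j" "j \<le> n" and x: "\<And>t. t \<in> lp_times (hard_instance n) \<Longrightarrow> t \<noteq> 1 \<Longrightarrow> t \<noteq> j \<Longrightarrow> x j t = 0"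
  shows "lp_use (hard_instance n) x j = x j 1 + x j j / rho n"
proof -
  have r: "0 < rho n" "rho n \<le> 1 / 4" using rho_bounds n by auto
  have "j * 1 \<le> n * n" using j n by (intro mult_le_mono) auto
  then have "{1, j} \<subseteq> lp_times (hard_instance n)" using j n by auto
  then have "lp_use (hard_instance n) x j = (\<Sum>t\<in>{1, j}. x j t / surv_exp (hard_instance n) j t)"
    unfolding lp_use_def using x by (intro sum.mono_neutral_right) auto
  also have "\<dots> = x j 1 + x j j / rho n"
    using j r expiry_surv_1[of j "rho n"] by (simp add: surv_exp_hard expiry_surv_eq)
  finally show ?thesis .
qed

lemma lp_use_filler:
  assumes n: "2 \<le> n" and x: "\<And>t. t \<in> lp_times (hard_instance n) \<Longrightarrow> t \<noteq> 2 \<Longrightarrow> x 1 t = 0"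
  shows "lp_use (hard_instance n) x 1 = x 1 2 / fill_rate n"
proof -
  have c: "0 < fill_rate n" "fill_rate n \<le> 1" using fill_rate_bounds n by auto
  have "2 * 1 \<le> n * n" using n by (intro mult_le_mono) auto
  then have "{2} \<subseteq> lp_times (hard_instance n)" by auto
  then have "lp_use (hard_instance n) x 1 = (\<Sum>t\<in>{2}. x 1 t / surv_exp (hard_instance n) 1 t)"
    unfolding lp_use_def using x by (intro sum.mono_neutral_right) auto
  then show ?thesis
    using c by (simp add: surv_exp_hard expiry_surv_eq)
qed

lemma lp_use_spread:
  assumes "2 \<le> n" "j \<in> opts (hard_instance n)"
  shows "lp_use (hard_instance n) (spread_solution n) j = 1"
proof (cases "j = 1")
  case True
  then show ?thesis
    using assms fill_rate_bounds[of n] by (simp add: lp_use_filler spread_solution_def)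
next
  case False
  then show ?thesis
    using assms rho_bounds[of n] by (simp add: lp_use_main spread_solution_def)
qed

text \<open>The filler begun at time 2 runs through time \<open>n + 1\<close>. Every time with a
  positive price is exactly full, as slackness requires; after time \<open>n\<close> at most the
  filler remains.\<close>

lemma lp_load_spread:
  assumes n: "2 \<le> n" and t: "1 \<le> t"
  shows "if t \<le> n then lp_load (hard_instance n) (spread_solution n) t = 1
         else lp_load (hard_instance n) (spread_solution n) t \<le> 1"
proof -
  have c: "0 < fill_rate n" "fill_rate n \<le> 1" using fill_rate_bounds n by auto
  have fill: "(\<Sum>\<tau>=1..t. if t - \<tau> < n then spread_solution n 1 \<tau> else 0)
      = (if 2 \<le> t \<and> t - 2 < n then fill_rate n else 0)"
  proof -
    have "(\<Sum>\<tau>=1..t. if t - \<tau> < n then spread_solution n 1 \<tau> else 0)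
        = (\<Sum>\<tau>=1..t. if \<tau> = 2 then (if t - 2 < n then fill_rate n else 0) else 0)"
      by (intro sum.cong) (auto simp: spread_solution_def)
    then show ?thesis by simp
  qed
  have main: "(\<Sum>j=2..n. spread_solution n j t)
      = (if t = 1 then 1 else if t \<le> n then rho n * (1 - 1 / (real n - 1)) else 0)"
  proof (cases "t = 1")
    case True
    have "(\<Sum>j=2..n. spread_solution n j t) = (\<Sum>j=2..n. 1 / (real n - 1))"
      using True by (intro sum.cong) (auto simp: spread_solution_def)
    then show ?thesis using True n by (simp add: of_nat_diff)
  next
    case False
    have "(\<Sum>j=2..n. spread_solution n j t)
        = (\<Sum>j=2..n. if j = t then rho n * (1 - 1 / (real n - 1)) else 0)"
      using False by (intro sum.cong) (auto simp: spread_solution_def)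
    then show ?thesis using False t by simp
  qed
  have "lp_load (hard_instance n) (spread_solution n) t
     = (if 2 \<le> t \<and> t - 2 < n then fill_rate n else 0)
      + (if t = 1 then 1 else if t \<le> n then rho n * (1 - 1 / (real n - 1)) else 0)"
    using lp_load_hard[of n t "spread_solution n"] n t unfolding fill main by simp
  then show ?thesis using n t c by (auto simp: fill_rate_def)
qed

lemma lp_feasible_spread:
  assumes n: "2 \<le> n"
  shows "lp_feasible (hard_instance n) (spread_solution n)"
  unfolding lp_feasible_def
proof (intro conjI allI impI ballI)
  have le: "k \<le> n * n" if "k \<le> n" for k
    using that n mult_le_mono[of k n 1 n] by simp
  show "spread_solution n j t = 0" if "j \<notin> opts (hard_instance n) \<or> t \<notin> lp_times (hard_instance n)" for j t
    using that n le[of j] le[of 2] le[of 1] by (auto simp: spread_solution_def)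
  show "(\<Sum>t\<in>lp_times (hard_instance n). spread_solution n j t / surv_exp (hard_instance n) j t) \<le> 1"
    if "j \<in> opts (hard_instance n)" for j
    using lp_use_spread[OF n that] by (simp add: lp_use_def)
  show "(\<Sum>\<tau>=1..t. \<Sum>j\<in>opts (hard_instance n). surv_eval (hard_instance n) j (t - \<tau>) * spread_solution n j \<tau>) \<le> 1"
    if "t \<in> lp_times (hard_instance n)" for t
    using lp_load_spread[OF n, of t] that by (auto simp: lp_load_def split: if_splits)
  show "0 \<le> spread_solution n j t" for j t
  proof -
    have "1 / (real n - 1) \<le> 1" using n by (simp add: divide_le_eq)
    then show ?thesis
      using n rho_bounds[of n] fill_rate_bounds[of n] by (auto simp: spread_solution_def)
  qed
qed

section \<open>Uniqueness of the masses at time 1\<close>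

text \<open>Slackness makes every use equal to 1 and leaves main option \<open>i\<close> only the
  times 1 and \<open>i\<close>. The room beside the filler at time \<open>i\<close> bounds
  \<open>x i 1\<close> from below, and the capacity of time 1 turns all these bounds into
  equalities.\<close>

lemma lp_optimal_hard:
  assumes n: "2 \<le> n" and x: "lp_optimal (hard_instance n) x" and j: "j \<in> {2..n}"
  shows "x j 1 = 1 / (real n - 1)"
proof -
  let ?I = "hard_instance n"
  have r: "0 < rho n" "rho n \<le> 1 / 4" using rho_bounds n by auto
  have c: "0 < fill_rate n" "fill_rate n \<le> 1" using fill_rate_bounds n by auto
  have le: "k \<le> n * n" if "k \<le> n" for k
    using that n mult_le_mono[of k n 1 n] by simp
  have dual_pos: "dual n i > 0" if "i \<in> opts ?I" for i
  proof (cases "i = 1")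
    case False
    then have "price n i \<le> 1 / 4" using that n by (intro price_le_quarter) auto
    then show ?thesis using False r by (simp add: dual_def)
  qed (use c n in \<open>simp add: dual_def\<close>)
  have red: "if (i = 1 \<and> t = 2) \<or> (i \<noteq> 1 \<and> (t = 1 \<or> t = i))
      then reduced_cost ?I (dual n) (price n) i t = 0
      else reduced_cost ?I (dual n) (price n) i t > 0"
    if "i \<in> opts ?I" "t \<in> lp_times ?I" for i t
  proof (cases "i = 1")
    case True
    then show ?thesis using reduced_cost_filler_sign[OF n, of t] that by (auto split: if_splits)
  next
    case False
    then show ?thesis using reduced_cost_main_sign[OF n, of i t] that by simp
  qed
  have spread_load: "lp_load ?I (spread_solution n) t = 1" if "t \<in> lp_times ?I" "price n t \<noteq> 0" for t
    using lp_load_spread[OF n, of t] that n by (auto simp: price_def split: if_splits)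
  have spread_red: "spread_solution n i t = 0"
    if "i \<in> opts ?I" "t \<in> lp_times ?I" "reduced_cost ?I (dual n) (price n) i t \<noteq> 0" for i t
    using red[OF that(1,2)] that(3) by (auto simp: spread_solution_def split: if_splits)
  have red0: "reduced_cost ?I (dual n) (price n) i t \<ge> 0" if "i \<in> opts ?I" "t \<in> lp_times ?I" for i t
    using red[OF that] by (auto split: if_splits)
  note slack = complementary_slackness[OF less_imp_le[OF dual_pos] price_nonneg red0
      lp_feasible_spread[OF n] lp_use_spread[OF n] spread_load spread_red x]
  have zero: "x i t = 0" if "i \<in> opts ?I" "t \<in> lp_times ?I"
    "\<not> ((i = 1 \<and> t = 2) \<or> (i \<noteq> 1 \<and> (t = 1 \<or> t = i)))" for i t
    using slack(2)[of i t] red[OF that(1,2)] that by auto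
  have use1: "lp_use ?I x i = 1" if "i \<in> opts ?I" for i
    using slack(1)[of i] dual_pos[OF that] that by auto
  have fx: "lp_feasible ?I x" using x by (simp add: lp_optimal_def)
  \<comment> \<open>Entries outside the program are 0 by feasibility, so no range condition on
    \<open>i\<close> and \<open>t\<close> is left.\<close>
  have x0: "x i t \<ge> 0" for i t
    using fx unfolding lp_feasible_def by (metis order_refl)
  have filler: "x 1 2 = fill_rate n"
    using lp_use_filler[OF n, of x] use1[of 1] zero[of 1] c n by (simp add: field_simps)
  have load: "lp_load ?I x t \<le> 1" if "1 \<le> t" "t \<le> n" for t
    using fx le[of t] that by (simp add: lp_feasible_def lp_load_def)
  have ge: "x i 1 \<ge> 1 / (real n - 1)" if i: "i \<in> {2..n}" for i
  proof -
    have "x i 1 + x i i / rho n = 1"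
      using lp_use_main[OF n, of i x] use1[of i] zero[of i] i by simp
    then have xi: "x i i = rho n * (1 - x i 1)" using r by (simp add: field_simps)
    \<comment> \<open>A filler begun at time 2 is still running at time \<open>i\<close>, since
      \<open>i - 2 < n\<close>.\<close>
    have "x 1 2 = (\<Sum>\<tau>\<in>{2}. if i - \<tau> < n then x 1 \<tau> else 0)"
      using i by auto
    also have "\<dots> \<le> (\<Sum>\<tau>=1..i. if i - \<tau> < n then x 1 \<tau> else 0)"
      using i x0 by (intro sum_mono2) auto
    finally have "x 1 2 \<le> (\<Sum>\<tau>=1..i. if i - \<tau> < n then x 1 \<tau> else 0)" .
    moreover have "x i i \<le> (\<Sum>k=2..n. x k i)"
      using i x0 by (intro member_le_sum) auto
    ultimately have "x 1 2 + x i i \<le> 1"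
      using lp_load_hard[of n i x] load[of i] i by simp
    then have "rho n * (1 - x i 1) \<le> rho n * (1 - 1 / (real n - 1))"
      unfolding filler xi by (simp add: fill_rate_def)
    then show ?thesis using r by simp
  qed
  have "(\<Sum>i=2..n. x i 1) \<le> 1"
    using lp_load_hard[of n 1 x] load[of 1] x0[of 1 1] n by simp
  also have "1 = (\<Sum>i=2..n. 1 / (real n - 1))" using n by (simp add: of_nat_diff)
  \<comment> \<open>By \<open>ge\<close> all these excesses are nonnegative; a sum of at most 0
    leaves no positive one.\<close>
  finally have "(\<Sum>i=2..n. x i 1 - 1 / (real n - 1)) \<le> 0" by (simp add: sum_subtractf)
  moreover have "x j 1 - 1 / (real n - 1) \<le> (\<Sum>i=2..n. x i 1 - 1 / (real n - 1))"
    using j ge by (intro member_le_sum) auto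
  ultimately show ?thesis using ge[OF j] by linarith
qed

section \<open>The linear program against the algorithm\<close>

text \<open>The time-1 part of the intended solution suffices: the main values are at least 1 and
  their masses sum to 1.\<close>

lemma lp_value_hard_ge:
  assumes n: "2 \<le> n"
  shows "lp_value (hard_instance n) \<ge> 1"
proof -
  let ?I = "hard_instance n"
  have n1: "1 \<le> n" using n by simp
  have r: "0 < rho n" "rho n \<le> 1 / 4" using rho_bounds n by auto
  have I: "sse_instance ?I" by (rule sse_instance_hard[OF n1])
  obtain x where x: "lp_optimal ?I x" using lp_optimal_exists[OF I] by blast
  have nonneg: "0 \<le> val ?I j * spread_solution n j t" if "j \<in> opts ?I" "t \<in> lp_times ?I" for j t
    using val_nonneg[OF I that(1)] lp_feasible_spread[OF n] that
    by (intro mult_nonneg_nonneg) (auto simp: lp_feasible_def)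
  have one: "1 \<in> lp_times ?I" using n mult_le_mono[of 1 n 1 n] by simp
  have "1 = (\<Sum>j=2..n. 1 / (real n - 1))" using n by (simp add: of_nat_diff)
  also have "\<dots> \<le> (\<Sum>j=2..n. val ?I j * spread_solution n j 1)"
  proof (rule sum_mono)
    fix j assume j: "j \<in> {2..n}"
    have "rho n * price n j \<le> rho n * 1"
      using r price_le_quarter[of j n] j n by (intro mult_left_mono) auto
    then have "1 \<le> val ?I j" using j r by (simp add: val_hard)
    from mult_right_mono[OF this, of "1 / (real n - 1)"]
    show "1 / (real n - 1) \<le> val ?I j * spread_solution n j 1"
      using j n by (simp add: spread_solution_def)
  qed
  also have "\<dots> \<le> (\<Sum>j\<in>opts ?I. val ?I j * spread_solution n j 1)"
    using n one by (intro sum_mono2 nonneg) auto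
  also have "\<dots> \<le> lp_objective ?I (spread_solution n)"
    unfolding lp_objective_def using nonneg one
    by (intro member_le_sum[where f = "\<lambda>t. \<Sum>j\<in>opts ?I. val ?I j * spread_solution n j t"] sum_nonneg) auto
  \<comment> \<open>The optimal \<open>x\<close> supplies the upper bound that the supremum
    needs.\<close>
  also have "\<dots> \<le> lp_value ?I"
    unfolding lp_value_def using lp_feasible_spread[OF n] x
    by (intro cSUP_upper bdd_aboveI2[of _ _ "lp_objective ?I x"]) (auto simp: lp_optimal_def)
  finally show ?thesis .
qed

text \<open>The time-1 bound is taken with the main options as \<open>M\<close>. The filler is
  counted in full, and each main option outlives time 2 with probability only
  \<open>rho n\<close>.\<close>

lemma alg_value_hard_le:
  assumes n: "2 \<le> n" and x: "lp_optimal (hard_instance n) x" and sel: "max_selector (hard_instance n) sel"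
  shows "alg_value (hard_instance n) x sel
    \<le> 1 / (1 - rho n) * (1 - (1 - 1 / 2 / real (n - 1)) ^ (n - 1) + real n * rho n) + 2 / real n"
proof -
  let ?I = "hard_instance n"
  define V where "V = 1 / (1 - rho n)"
  have n1: "1 \<le> n" using n by simp
  have r: "0 < rho n" "rho n \<le> 1 / 4" using rho_bounds n by auto
  have V0: "V \<ge> 0" using r by (simp add: V_def)
  have "val ?I j \<le> V" if "j \<in> {2..n}" for j
    using that r price_nonneg[of n j] by (simp add: val_hard V_def divide_right_mono)
  moreover have "0 \<le> x j 1 \<and> x j 1 \<le> 1" if "j \<in> {2..n}" for j
    using lp_optimal_hard[OF n x that] n by (simp add: divide_le_eq)
  moreover have "{2..n} \<subseteq> opts ?I" by auto
  ultimately have "alg_value ?I x sel \<le> V * (1 - (\<Prod>j=2..n. 1 - x j 1 / 2))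
      + (\<Sum>j\<in>opts ?I - {2..n}. val ?I j) + (\<Sum>j=2..n. V * surv_exp ?I j 2)"
    by (intro alg_value_le_time_1[OF sse_instance_hard[OF n1] sel _ _ V0]) auto
  also have "(\<Prod>j=2..n. 1 - x j 1 / 2) = (\<Prod>j=2..n. 1 - 1 / 2 / real (n - 1))"
    using lp_optimal_hard[OF n x] n by (intro prod.cong) (auto simp: of_nat_diff)
  also have "\<dots> = (1 - 1 / 2 / real (n - 1)) ^ (n - 1)"
    by (simp only: prod_constant card_atLeastAtMost) simp
  also have "opts ?I - {2..n} = {1}" using n by auto
  also have "(\<Sum>j\<in>{1}. val ?I j) \<le> 2 / real n"
    using sum_price_le[OF n1] by (simp add: val_hard)
  also have "(\<Sum>j=2..n. V * surv_exp ?I j 2) = (real n - 1) * (V * rho n)"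
    using r n by (simp add: surv_exp_hard expiry_surv_eq of_nat_diff)
  also have "\<dots> \<le> real n * (V * rho n)"
    using V0 r by (intro mult_right_mono) auto
  finally show ?thesis
    by (simp add: V_def algebra_simps)
qed

lemma alg_bound_tendsto:
  "(\<lambda>n. 1 / (1 - rho n) * (1 - (1 - 1 / 2 / real (n - 1)) ^ (n - 1) + real n * rho n) + 2 / real n)
    \<longlonglongrightarrow> 1 - 1 / sqrt (exp 1)"
proof -
  have "(\<lambda>m. (1 + (-1/2) / real m) ^ m) \<longlonglongrightarrow> exp (-1/2)"
    by (rule tendsto_exp_limit_sequentially)
  \<comment> \<open>Shifting the index turns \<open>n - 1\<close> into the \<open>m\<close> of the
    exponential limit.\<close>
  then have "(\<lambda>n. (1 - 1 / 2 / real (Suc n - 1)) ^ (Suc n - 1)) \<longlonglongrightarrow> exp (-1/2)"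
    by simp
  then have 1: "(\<lambda>n. (1 - 1 / 2 / real (n - 1)) ^ (n - 1)) \<longlonglongrightarrow> exp (-1/2)"
    by (rule LIMSEQ_imp_Suc)
  have 2: "rho \<longlonglongrightarrow> 0" "(\<lambda>n. real n * rho n) \<longlonglongrightarrow> 0" "(\<lambda>n. 2 / real n) \<longlonglongrightarrow> 0"
    unfolding rho_def by real_asymp+
  have "sqrt (exp 1) = exp (1/2)"
    by (rule real_sqrt_unique) (simp_all add: power2_eq_square flip: exp_add)
  then have "exp (-1/2) = 1 / sqrt (exp (1::real))"
    by (simp add: exp_minus inverse_eq_divide)
  moreover have "(\<lambda>n. 1 / (1 - rho n) * (1 - (1 - 1 / 2 / real (n - 1)) ^ (n - 1) + real n * rho n) + 2 / real n)
      \<longlonglongrightarrow> 1 / (1 - 0) * (1 - exp (-1/2) + 0) + 0"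
    by (intro tendsto_intros 1 2) simp
  ultimately show ?thesis by simp
qed

theorem lemma3p6:
  shows "\<exists>I :: nat \<Rightarrow> sse.
    (\<forall>n\<ge>1. sse_instance (I n) \<and> num_opts (I n) = n) \<and>
    (\<forall>x sel. (\<forall>n\<ge>1. lp_optimal (I n) (x n) \<and> max_selector (I n) (sel n)) \<longrightarrow>
       limsup (\<lambda>n. ereal (alg_value (I n) (x n) (sel n) / lp_value (I n)))
         \<le> ereal (1 - 1 / sqrt (exp 1)))"
proof (intro exI conjI allI impI)
  show "sse_instance (hard_instance n)" "num_opts (hard_instance n) = n" if "n \<ge> 1" for n
    using sse_instance_hard[OF that] by simp_all
  fix x sel
  assume opt: "\<forall>n\<ge>1. lp_optimal (hard_instance n) (x n) \<and> max_selector (hard_instance n) (sel n)"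
  let ?B = "\<lambda>n. 1 / (1 - rho n) * (1 - (1 - 1 / 2 / real (n - 1)) ^ (n - 1) + real n * rho n) + 2 / real n"
  have "alg_value (hard_instance n) (x n) (sel n) / lp_value (hard_instance n) \<le> ?B n" if n: "n \<ge> 2" for n
  proof -
    have lp: "lp_value (hard_instance n) \<ge> 1" by (rule lp_value_hard_ge[OF n])
    have "(1 - 1 / 2 / real (n - 1)) ^ (n - 1) \<le> 1"
      using n by (intro power_le_one) (auto simp: field_simps)
    moreover have "0 < rho n" "rho n \<le> 1 / 4" using rho_bounds n by auto
    ultimately have "0 \<le> ?B n"
      by (intro add_nonneg_nonneg mult_nonneg_nonneg) auto
    have "alg_value (hard_instance n) (x n) (sel n) / lp_value (hard_instance n)
        \<le> ?B n / lp_value (hard_instance n)"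
      using alg_value_hard_le[OF n] opt n lp by (intro divide_right_mono) auto
    also have "\<dots> \<le> ?B n / 1"
      using lp \<open>0 \<le> ?B n\<close> by (intro divide_left_mono) auto
    finally show ?thesis by simp
  qed
  then have "limsup (\<lambda>n. ereal (alg_value (hard_instance n) (x n) (sel n) / lp_value (hard_instance n)))
      \<le> limsup (\<lambda>n. ereal (?B n))"
    by (intro Limsup_mono eventually_sequentiallyI[of 2]) simp
  also have "\<dots> = ereal (1 - 1 / sqrt (exp 1))"
    using alg_bound_tendsto by (intro lim_imp_Limsup) auto
  finally show "limsup (\<lambda>n. ereal (alg_value (hard_instance n) (x n) (sel n) / lp_value (hard_instance n)))
      \<le> ereal (1 - 1 / sqrt (exp 1))" .
qed

end
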